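(* Let $X\subseteq\mathbb{R}^{p}$, $Y\subseteq\mathbb{R}^{m}$ be closed convex sets and $W=X\times Y$. Suppose $f:W\to\mathbb{R}$ is $L$-smooth, $f(x,y)$ is convex in $x$ for all $y\in Y$, and concave in $y$ for all $x\in X$. Distances are Euclidean. Let $\theta\in(0,L]$, $\gamma\in(0,1/L]$, $\beta\in(0,1)$, $\epsilon\in(0,1)$. Let $W^*$ (nonempty) be the optimal set defined in the context and suppose that for all $w\in W$, with $r^*=\|W^*-w\|$, one has $\theta(r^* )^2\le\Delta_{r^*}(w)$. Define $$t^*:=\frac{4(1+\beta)^2}{\beta^2}\,\frac1{\gamma\theta}+2 .$$ Let $\{v_i\}_{i\ge0}$, $\{\tau_i\}_{i\ge1}$ be generated by adaptively restarted extragradient (defined in the context) with step size $\gamma$ and parameter $\beta$, from $v_0\in W$ and with arbitrary initial epoch length $\tau_1\in\mathbb{N}$. Then for $$n=\left\lceil\log_{1/\beta}\!\left(\frac2\epsilon\max\left\{1,\frac{t^*}{\tau_1}\right\}\right)\right\rceil$$ one has $\|W^*-v_n\|\le\epsilon\,\|W^*-v_0\|$ and $\sum_{i=1}^n\tau_i\le t^*n+2(\tau_1-t^* )^+$.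
   Context: $\mathbb{N}=\{1,2,\dots\}$; $(a)^+=\max\{a,0\}$; $\|\cdot\|$ is the Euclidean norm; $w=(w_x,w_y)\in W$; $B_r(w)=\{\hat w\in W:\|w-\hat w\|\le r\}$; $\|\hat W-w\|=\inf_{\hat w\in\hat W}\|\hat w-w\|$. $f$ is $L$-smooth if it is differentiable with $\|\nabla f(w)-\nabla f(w')\|_2\le L\|w-w'\|_2$ for all $w,w'\in W$. The localized duality gap is $\Delta_r(w)=\sup_{(x,y)\in B_r(w)} f(w_x,y)-f(x,w_y)$ and $W^*=\{w\in W:\Delta_r(w)=0\ \forall r>0\}$. Put $g(w)=\big(\nabla_xf(w_x,w_y),\,-\nabla_yf(w_x,w_y)\big)$. Extragradient from $v\in W$ with step size $\gamma$: set $u^0=v$ and for $t=1,2,\dots$ $$z^t=\arg\min_{w\in W}g(u^{t-1})^Tw+\tfrac1\gamma\|w-u^{t-1}\|_2^2,\qquad u^t=\arg\min_{w\in W}g(z^t)^Tw+\tfrac1\gamma\|w-u^{t-1}\|_2^2 .$$ The output at step $t$ is the running average $w^t(v)=\frac1t\sum_{k=1}^tu^k$. Adaptively restarted extragradient with parameter $\beta$: given $v_0\in W$, for epochs $i=1,2,\dots$ run extragradient from $v_{i-1}$, producing $w_i^t=w^t(v_{i-1})$. Epoch $1$ is stopped after an arbitrarily chosen number $\tau_1\in\mathbb{N}$ of steps. For $i>1$, epoch $i$ is stopped at the first $t\in\mathbb{N}$ (called $\tau_i$) with $$\frac{\|w_i^t-v_{i-1}\|}{t}\le\beta\,\frac{\|v_{i-1}-v_{i-2}\|}{\tau_{i-1}}.$$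 Set $v_i=w_i^{\tau_i}$. *)

theory Defs
  imports "HOL-Analysis.Analysis"
begin

text \<open>
  The norm on the product type is the Euclidean norm of the concatenated vector, so
  \<open>norm\<close>, \<open>dist\<close> and the inner product on \<open>real^'p \<times> real^'m\<close> are those of the
  Euclidean space of dimension \<open>p + m\<close>.
\<close>

text \<open>
  The function \<open>f\<close> lives on \<open>W\<close> only, so it is differentiated within \<open>W\<close>.  If \<open>W\<close> has empty
  interior such a gradient is not unique; hence the gradient field \<open>G\<close> is an explicit argument.
\<close>

definition smooth_with_gradient ::
    "real \<Rightarrow> 'a::real_inner set \<Rightarrow> ('a \<Rightarrow> real) \<Rightarrow> ('a \<Rightarrow> 'a) \<Rightarrow> bool" where
  "smooth_with_gradient L W f G \<longleftrightarrow>
     (\<forall>w\<in>W. (f has_derivative (\<lambda>h. G w \<bullet> h)) (at w within W)) \<and>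
     (\<forall>w\<in>W. \<forall>w'\<in>W. norm (G w - G w') \<le> L * norm (w - w'))"

text \<open>
  The supremum is a real one.  For closed \<open>W\<close>, \<open>w \<in> W\<close>, \<open>r \<ge> 0\<close> and \<open>f\<close> continuous on a product
  set \<open>W\<close>, it is taken over a continuous function on a nonempty compact set.
\<close>

definition local_gap ::
    "('a::euclidean_space \<times> 'b::euclidean_space \<Rightarrow> real) \<Rightarrow> ('a \<times> 'b) set \<Rightarrow> real \<Rightarrow> 'a \<times> 'b \<Rightarrow> real" where
  "local_gap f W r w = (SUP (x, y) \<in> W \<inter> cball w r. f (fst w, y) - f (x, snd w))"

definition optimal_set ::
    "('a::euclidean_space \<times> 'b::euclidean_space \<Rightarrow> real) \<Rightarrow> ('a \<times> 'b) set \<Rightarrow> ('a \<times> 'b) set" where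
  "optimal_set f W = {w \<in> W. \<forall>r>0. local_gap f W r w = 0}"

definition saddle_operator ::
    "('a::real_vector \<times> 'b::real_vector \<Rightarrow> 'a \<times> 'b) \<Rightarrow> 'a \<times> 'b \<Rightarrow> 'a \<times> 'b" where
  "saddle_operator G w = (fst (G w), - snd (G w))"

text \<open>
  For a nonempty closed convex \<open>W\<close> and \<open>\<gamma> > 0\<close> the objective below is strongly convex, so the
  minimiser exists and is unique.
\<close>

definition prox_step :: "'a::real_inner set \<Rightarrow> real \<Rightarrow> 'a \<Rightarrow> 'a \<Rightarrow> 'a" where
  "prox_step W \<gamma> d u = arg_min_on (\<lambda>w. d \<bullet> w + 1 / \<gamma> * (norm (w - u))\<^sup>2) W"

primrec extragradient ::
    "'a::real_inner set \<Rightarrow> ('a \<Rightarrow> 'a) \<Rightarrow> real \<Rightarrow> 'a \<Rightarrow> nat \<Rightarrow> 'a" where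
  "extragradient W g \<gamma> v 0 = v"
| "extragradient W g \<gamma> v (Suc t) =
     (let u = extragradient W g \<gamma> v t;
          z = prox_step W \<gamma> (g u) u
      in prox_step W \<gamma> (g z) u)"

definition extragradient_avg ::
    "'a::real_inner set \<Rightarrow> ('a \<Rightarrow> 'a) \<Rightarrow> real \<Rightarrow> 'a \<Rightarrow> nat \<Rightarrow> 'a" where
  "extragradient_avg W g \<gamma> v t = (1 / real t) *\<^sub>R (\<Sum>k=1..t. extragradient W g \<gamma> v k)"

text \<open>
  \<open>\<tau> 1\<close> is unconstrained apart from being positive; the value \<open>\<tau> 0\<close> is never used.  That some \<open>t\<close>
  meets the restart criterion is not assumed: \<open>LEAST\<close> is unspecified if there is none, so proving
  a bound on \<open>\<tau> i\<close> requires showing that the epoch terminates.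
\<close>

definition adaptively_restarted_extragradient ::
    "'a::real_inner set \<Rightarrow> ('a \<Rightarrow> 'a) \<Rightarrow> real \<Rightarrow> real \<Rightarrow> (nat \<Rightarrow> 'a) \<Rightarrow> (nat \<Rightarrow> nat) \<Rightarrow> bool" where
  "adaptively_restarted_extragradient W g \<gamma> \<beta> v \<tau> \<longleftrightarrow>
     v 0 \<in> W \<and> 1 \<le> \<tau> 1 \<and>
     (\<forall>i>1. \<tau> i = (LEAST t. 1 \<le> t \<and>
        norm (extragradient_avg W g \<gamma> (v (i - 1)) t - v (i - 1)) / real t
          \<le> \<beta> * (norm (v (i - 1) - v (i - 2)) / real (\<tau> (i - 1))))) \<and>
     (\<forall>i\<ge>1. v i = extragradient_avg W g \<gamma> (v (i - 1)) (\<tau> i))"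

end

theory Submission
  imports Defs
begin

text \<open>
  The output averages the corrector points \<open>u\<close>, whereas the ergodic gap bound holds for the average
  of the predictor points \<open>z\<close>.  Growth is therefore applied at the average of the \<open>z\<close>, and the
  distance \<open>e\<close> between the two averages is bounded separately.  With \<open>d\<close> the surplus in the Fejer
  inequality of one step and \<open>E\<close> the sum of the \<open>d\<close> over the \<open>t\<close> steps of an epoch, the gap at the
  average of the \<open>z\<close> improves by \<open>E / (\<gamma> * t)\<close>, while \<open>e\<^sup>2\<close> is at most \<open>E / (3 * t)\<close> and, since
  \<open>d\<close> is at least a constant times \<open>(\<gamma> * \<theta>)\<^sup>2\<close> times the squared distance to the optimal set,
  also at most \<open>15 * E / (\<gamma> * \<theta> * t)\<^sup>2\<close>.  Trading \<open>E\<close> against \<open>e\<close> shows that an epoch that moves by \<open>D\<close>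
  ends within \<open>8 * D / s\<close> of the optimal set if \<open>s = \<gamma> * \<theta> * t \<le> 16\<close>, and within
  \<open>D / (sqrt s - 2)\<close> if \<open>s \<ge> 16\<close>; these two bounds are exactly what the constants in
  \<open>t\<^sup>*\<close> require.  As the next epoch never moves by more than twice the distance to the optimal set,
  its length exceeds \<open>t\<^sup>*\<close> by at most half of the previous excess, and the geometric decay of
  \<open>D / t\<close> enforced by the restart criterion gives the linear rate.
\<close>

subsection \<open>Extragradient steps\<close>

text \<open>Write \<open>d\<close> as the difference of the squares of \<open>sqrt (A + d)\<close>
  and \<open>sqrt A\<close>. Since \<open>sqrt (A + d)\<close> is at most
  \<open>sqrt (M * d)\<close>, one factor \<open>sqrt d\<close> cancels. With \<open>A\<close> a
  tail sum, the right-hand side telescopes.\<close>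

lemma sqrt_tail_increment:
  fixes A d M :: real
  assumes "0 \<le> A" "0 \<le> d" "0 \<le> M" "A + d \<le> M * d"
  shows "sqrt d \<le> 2 * sqrt M * (sqrt (A + d) - sqrt A)"
proof (cases "d = 0")
  case True
  then show ?thesis by simp
next
  case False
  let ?h = "sqrt (A + d) - sqrt A"
  have h: "0 \<le> ?h" using assms by simp
  have "sqrt d * sqrt d = ?h * (sqrt (A + d) + sqrt A)" using assms by (simp add: algebra_simps)
  also have "\<dots> \<le> ?h * (2 * sqrt (A + d))" using assms h by (intro mult_left_mono) auto
  also have "\<dots> \<le> ?h * (2 * sqrt (M * d))" using assms h by (intro mult_left_mono) auto
  finally have "sqrt d * sqrt d \<le> (2 * sqrt M * ?h) * sqrt d" by (simp add: real_sqrt_mult algebra_simps)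
  thus ?thesis by (rule mult_right_le_imp_le) (use False assms in auto)
qed

text \<open>The roots of the tail sums telescope, which avoids the factor \<open>sqrt n\<close> that
  Cauchy-Schwarz would cost.\<close>

lemma sum_sqrt_le_of_tails:
  fixes d :: "nat \<Rightarrow> real"
  assumes nonneg: "\<And>k. k < n \<Longrightarrow> 0 \<le> d k" and "0 \<le> M"
    and tail: "\<And>k. k < n \<Longrightarrow> (\<Sum>j=k..<n. d j) \<le> M * d k"
  shows "(\<Sum>k<n. sqrt (d k)) \<le> 2 * sqrt M * sqrt (\<Sum>k<n. d k)"
proof -
  let ?S = "\<lambda>k. \<Sum>j=k..<n. d j"
  have "sqrt (d k) \<le> 2 * sqrt M * (sqrt (?S k) - sqrt (?S (Suc k)))" if "k < n" for k
  proof -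
    have S: "?S k = ?S (Suc k) + d k" using that by (simp add: sum.atLeast_Suc_lessThan)
    have "0 \<le> ?S (Suc k)" using nonneg by (intro sum_nonneg) auto
    thus ?thesis unfolding S using tail[OF that] nonneg[OF that] \<open>0 \<le> M\<close>
      unfolding S by (intro sqrt_tail_increment) auto
  qed
  hence "(\<Sum>k<n. sqrt (d k)) \<le> (\<Sum>k<n. 2 * sqrt M * (sqrt (?S k) - sqrt (?S (Suc k))))"
    by (intro sum_mono) auto
  also have "\<dots> = 2 * sqrt M * sqrt (?S 0)"
    using sum_lessThan_telescope'[of "\<lambda>k. sqrt (?S k)" n] by (simp flip: sum_distrib_left)
  finally show ?thesis by (simp add: lessThan_atLeast0)
qed

section \<open>The prox step as a projection\<close>

locale extragradient_method =
  fixes W :: "'a::euclidean_space set" and g :: "'a \<Rightarrow> 'a" and \<gamma> :: real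
  assumes closed_W: "closed W" and convex_W: "convex W" and step_pos: "0 < \<gamma>"
    and lipschitz: "\<And>w w'. w \<in> W \<Longrightarrow> w' \<in> W \<Longrightarrow> \<gamma> * norm (g w - g w') \<le> norm (w - w')"
begin

text \<open>Completing the square turns the objective into a squared distance up to scaling and a
  constant. The weight \<open>1 / \<gamma>\<close> instead of \<open>1 / (2 * \<gamma>)\<close>
  makes the shift \<open>\<gamma> / 2\<close>.\<close>

lemma prox_step_eq_closest_point:
  assumes "W \<noteq> {}"
  shows "prox_step W \<gamma> d u = closest_point W (u - (\<gamma> / 2) *\<^sub>R d)"
proof -
  let ?c = "u - (\<gamma> / 2) *\<^sub>R d" and ?F = "\<lambda>w. d \<bullet> w + 1 / \<gamma> * (norm (w - u))\<^sup>2"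
  have sq: "?F w = 1 / \<gamma> * (dist ?c w)\<^sup>2 + (d \<bullet> u - \<gamma> / 4 * (d \<bullet> d))" for w
    using step_pos unfolding dist_norm power2_norm_eq_inner
    by (simp add: field_simps power2_eq_square inner_simps inner_commute)
  have less: "?F w < ?F w' \<longleftrightarrow> dist ?c w < dist ?c w'" for w w'
    unfolding sq not_le[symmetric] using step_pos power_mono_iff[of "dist ?c w'" "dist ?c w" 2]
    by (simp add: divide_le_cancel)
  have "is_arg_min ?F (\<lambda>w. w \<in> W) (closest_point W ?c)"
    unfolding is_arg_min_def less
    using closest_point_in_set[OF closed_W assms] closest_point_le[OF closed_W] by (auto simp: not_less)
  \<comment> \<open>\<open>arg_min\<close> is a choice operator, so this yields some minimiser only;
    uniqueness of the nearest point then identifies it.\<close>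
  hence "is_arg_min ?F (\<lambda>w. w \<in> W) (prox_step W \<gamma> d u)"
    unfolding prox_step_def arg_min_on_def arg_min_def by (rule someI)
  hence "prox_step W \<gamma> d u \<in> W" "\<forall>w\<in>W. dist ?c (prox_step W \<gamma> d u) \<le> dist ?c w"
    unfolding is_arg_min_def less by (auto simp: not_less)
  thus ?thesis by (intro closest_point_unique convex_W closed_W)
qed

lemma prox_step_in: "u \<in> W \<Longrightarrow> prox_step W \<gamma> d u \<in> W"
  by (subst prox_step_eq_closest_point) (auto intro: closest_point_in_set closed_W)

lemma prox_step_dot:
  assumes "w \<in> W"
  shows "\<gamma> * (d \<bullet> (prox_step W \<gamma> d u - w)) \<le> 2 * ((u - prox_step W \<gamma> d u) \<bullet> (prox_step W \<gamma> d u - w))"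
proof -
  have "W \<noteq> {}" using assms by auto
  have "(u - (\<gamma> / 2) *\<^sub>R d - prox_step W \<gamma> d u) \<bullet> (w - prox_step W \<gamma> d u) \<le> 0"
    unfolding prox_step_eq_closest_point[OF \<open>W \<noteq> {}\<close>]
    by (rule closest_point_dot[OF convex_W closed_W assms])
  moreover have "(u - (\<gamma> / 2) *\<^sub>R d - p) \<bullet> (w - p) = \<gamma> / 2 * (d \<bullet> (p - w)) - (u - p) \<bullet> (p - w)" for p
    by (simp add: inner_simps algebra_simps)
  ultimately show ?thesis by simp
qed

text \<open>Polarisation turns the variational inequality of the projection into squared distances,
  which telescope along the iteration.\<close>

lemma prox_step_three_point:
  assumes "w \<in> W"
  shows "\<gamma> * (d \<bullet> (prox_step W \<gamma> d u - w))
    \<le> (norm (u - w))\<^sup>2 - (norm (prox_step W \<gamma> d u - w))\<^sup>2 - (norm (prox_step W \<gamma> d u - u))\<^sup>2"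
proof -
  have "2 * ((u - p) \<bullet> (p - w)) = (norm (u - w))\<^sup>2 - (norm (p - w))\<^sup>2 - (norm (p - u))\<^sup>2" for p
    by (simp add: power2_norm_eq_inner inner_simps inner_commute algebra_simps)
  thus ?thesis using prox_step_dot[OF assms, of d u] by simp
qed

lemma prox_step_nonexpansive:
  assumes "u \<in> W"
  shows "norm (prox_step W \<gamma> d u - prox_step W \<gamma> d' u) \<le> \<gamma> / 2 * norm (d - d')"
proof -
  have "W \<noteq> {}" using assms by auto
  have "norm (prox_step W \<gamma> d u - prox_step W \<gamma> d' u)
      \<le> dist (u - (\<gamma> / 2) *\<^sub>R d) (u - (\<gamma> / 2) *\<^sub>R d')"
    unfolding prox_step_eq_closest_point[OF \<open>W \<noteq> {}\<close>] dist_norm[of "closest_point _ _", symmetric]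
    by (rule closest_point_lipschitz[OF convex_W closed_W \<open>W \<noteq> {}\<close>])
  also have "\<dots> = norm ((\<gamma> / 2) *\<^sub>R (d' - d))" by (simp add: dist_norm algebra_simps)
  also have "\<dots> = \<gamma> / 2 * norm (d - d')" using step_pos by (simp add: norm_minus_commute)
  finally show ?thesis .
qed

abbreviation iter :: "'a \<Rightarrow> nat \<Rightarrow> 'a" where
  "iter \<equiv> extragradient W g \<gamma>"

text \<open>In the numbering of the algorithm, \<open>iter v k\<close> is u^k and
  \<open>half_iter v k\<close> is z^(k+1), the predictor computed from u^k.\<close>

definition half_iter :: "'a \<Rightarrow> nat \<Rightarrow> 'a" where
  "half_iter v k = prox_step W \<gamma> (g (iter v k)) (iter v k)"

lemma iter_Suc: "iter v (Suc k) = prox_step W \<gamma> (g (half_iter v k)) (iter v k)"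
  by (simp add: half_iter_def Let_def)

declare extragradient.simps(2) [simp del]

lemma iter_in: "v \<in> W \<Longrightarrow> iter v k \<in> W"
  by (induction k) (simp_all add: iter_Suc prox_step_in)

lemma half_iter_in: "v \<in> W \<Longrightarrow> half_iter v k \<in> W"
  by (simp add: half_iter_def prox_step_in iter_in)

section \<open>Fejer inequality of one step\<close>

definition predictor_move :: "'a \<Rightarrow> nat \<Rightarrow> real" where
  "predictor_move v k = norm (half_iter v k - iter v k)"

definition corrector_move :: "'a \<Rightarrow> nat \<Rightarrow> real" where
  "corrector_move v k = norm (iter v (Suc k) - half_iter v k)"

text \<open>The surplus left in the one-step inequality once its cross term is bounded by the
  product of the two moves.\<close>

definition decrease :: "'a \<Rightarrow> nat \<Rightarrow> real" where
  "decrease v k = (predictor_move v k)\<^sup>2 + (corrector_move v k)\<^sup>2 - predictor_move v k * corrector_move v k"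

text \<open>Both points are prox steps from the same u^k with different gradients; projection
  contributes the factor 1/2 and \<open>lipschitz\<close> absorbs the step size.\<close>

lemma corrector_le_predictor:
  assumes "v \<in> W"
  shows "2 * corrector_move v k \<le> predictor_move v k"
proof -
  have "2 * corrector_move v k \<le> \<gamma> * norm (g (half_iter v k) - g (iter v k))"
    using prox_step_nonexpansive[OF iter_in[OF assms], of "g (half_iter v k)" k "g (iter v k)"]
    by (simp add: corrector_move_def iter_Suc half_iter_def[of v k])
  also have "\<dots> \<le> predictor_move v k"
    unfolding predictor_move_def using assms by (intro lipschitz half_iter_in iter_in)
  finally show ?thesis .
qed

lemma predictor_sq_le_decrease: "3 / 4 * (predictor_move v k)\<^sup>2 \<le> decrease v k"
  using zero_le_power2[of "predictor_move v k / 2 - corrector_move v k"]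
  by (simp add: decrease_def power2_eq_square algebra_simps)

lemma decrease_nonneg: "0 \<le> decrease v k"
  by (rule order_trans[OF _ predictor_sq_le_decrease]) simp

text \<open>With a and c the two moves, a^2 + c^2 - a c - 3 c^2 factors as (a - 2 c) (a +
  c).\<close>

lemma corrector_sq_le_decrease:
  assumes "v \<in> W"
  shows "3 * (corrector_move v k)\<^sup>2 \<le> decrease v k"
proof -
  have "0 \<le> (predictor_move v k - 2 * corrector_move v k) * (predictor_move v k + corrector_move v k)"
    using corrector_le_predictor[OF assms, of k]
    by (intro mult_nonneg_nonneg) (auto simp: predictor_move_def corrector_move_def)
  thus ?thesis by (simp add: decrease_def power2_eq_square algebra_simps)
qed

text \<open>The corrector step is tested at \<open>w\<close>, the predictor step at the corrector
  point. In the sum the distance between \<open>?p\<close> and \<open>?u\<close> cancels, and the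
  mismatch of the two gradients is the cross term in \<open>decrease\<close>.\<close>

lemma iteration_inequality:
  assumes v: "v \<in> W" and w: "w \<in> W"
  shows "\<gamma> * (g (half_iter v k) \<bullet> (half_iter v k - w))
    \<le> (norm (iter v k - w))\<^sup>2 - (norm (iter v (Suc k) - w))\<^sup>2 - decrease v k"
proof -
  let ?u = "iter v k" and ?z = "half_iter v k" and ?p = "iter v (Suc k)"
  have 1: "\<gamma> * (g ?z \<bullet> (?p - w)) \<le> (norm (?u - w))\<^sup>2 - (norm (?p - w))\<^sup>2 - (norm (?p - ?u))\<^sup>2"
    unfolding iter_Suc by (rule prox_step_three_point[OF w])
  have 2: "\<gamma> * (g ?u \<bullet> (?z - ?p)) \<le> (norm (?u - ?p))\<^sup>2 - (norm (?z - ?p))\<^sup>2 - (norm (?z - ?u))\<^sup>2"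
    unfolding half_iter_def[of v k] by (rule prox_step_three_point[OF iter_in[OF v]])
  have "\<gamma> * ((g ?z - g ?u) \<bullet> (?z - ?p)) \<le> \<gamma> * (norm (g ?z - g ?u) * norm (?z - ?p))"
    using step_pos norm_cauchy_schwarz by (intro mult_left_mono) auto
  also have "\<dots> = (\<gamma> * norm (g ?z - g ?u)) * norm (?z - ?p)" by simp
  also have "\<dots> \<le> norm (?z - ?u) * norm (?z - ?p)"
    by (intro mult_right_mono lipschitz half_iter_in iter_in v) auto
  finally have 3: "\<gamma> * ((g ?z - g ?u) \<bullet> (?z - ?p)) \<le> norm (?z - ?u) * norm (?z - ?p)" .
  have "\<gamma> * (g ?z \<bullet> (?z - w)) = \<gamma> * (g ?z \<bullet> (?p - w)) + \<gamma> * (g ?u \<bullet> (?z - ?p)) + \<gamma> * ((g ?z - g ?u) \<bullet> (?z - ?p))"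
    by (simp add: inner_simps algebra_simps)
  thus ?thesis using 1 2 3
    by (simp add: decrease_def predictor_move_def corrector_move_def norm_minus_commute)
qed

lemma sum_iteration_inequality:
  assumes "v \<in> W" "w \<in> W"
  shows "\<gamma> * (\<Sum>k<n. g (half_iter v k) \<bullet> (half_iter v k - w))
    \<le> (norm (v - w))\<^sup>2 - (norm (iter v n - w))\<^sup>2 - (\<Sum>k<n. decrease v k)"
proof (induction n)
  case (Suc n)
  then show ?case using iteration_inequality[OF assms, of n] by (simp add: algebra_simps)
qed simp

section \<open>Averages over an epoch\<close>

definition half_avg :: "'a \<Rightarrow> nat \<Rightarrow> 'a" where
  "half_avg v n = (1 / real n) *\<^sub>R (\<Sum>k<n. half_iter v k)"

abbreviation avg :: "'a \<Rightarrow> nat \<Rightarrow> 'a" where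
  "avg \<equiv> extragradient_avg W g \<gamma>"

lemma avg_eq: "avg v n = (1 / real n) *\<^sub>R (\<Sum>k<n. iter v (Suc k))"
  by (simp add: extragradient_avg_def sum.atLeast1_atMost_eq)

lemma mean_in:
  assumes "1 \<le> n" "\<And>k. k < n \<Longrightarrow> p k \<in> W"
  shows "(1 / real n) *\<^sub>R (\<Sum>k<n. p k) \<in> W"
proof -
  have "(\<Sum>k<n. (1 / real n) *\<^sub>R p k) \<in> W"
    by (rule convex_sum[OF _ convex_W]) (use assms in auto)
  thus ?thesis by (simp add: scaleR_right.sum)
qed

lemma avg_in: "v \<in> W \<Longrightarrow> 1 \<le> n \<Longrightarrow> avg v n \<in> W"
  unfolding avg_eq by (intro mean_in iter_in)

lemma half_avg_in: "v \<in> W \<Longrightarrow> 1 \<le> n \<Longrightarrow> half_avg v n \<in> W"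
  unfolding half_avg_def by (intro mean_in half_iter_in)

lemma avg_dist_half_avg:
  assumes "1 \<le> n"
  shows "real n * norm (avg v n - half_avg v n) \<le> (\<Sum>k<n. corrector_move v k)"
proof -
  have "real n * norm (avg v n - half_avg v n) = norm (real n *\<^sub>R (avg v n - half_avg v n))" by simp
  also have "real n *\<^sub>R (avg v n - half_avg v n) = (\<Sum>k<n. iter v (Suc k) - half_iter v k)"
    using assms by (simp add: avg_eq half_avg_def sum_subtractf scaleR_right_diff_distrib)
  also have "norm \<dots> \<le> (\<Sum>k<n. corrector_move v k)"
    unfolding corrector_move_def by (rule norm_sum)
  finally show ?thesis .
qed

text \<open>The two averages pair the points of the same step, so Cauchy-Schwarz over the corrector
  moves applies.\<close>

lemma avg_dist_half_avg_sq:
  assumes "v \<in> W" "1 \<le> n"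
  shows "3 * real n * (norm (avg v n - half_avg v n))\<^sup>2 \<le> (\<Sum>k<n. decrease v k)"
proof -
  let ?e = "norm (avg v n - half_avg v n)"
  have "(real n * ?e)\<^sup>2 \<le> (\<Sum>k<n. corrector_move v k)\<^sup>2"
    using avg_dist_half_avg[OF assms(2)] by (intro power_mono) auto
  also have "\<dots> \<le> real (card {..<n}) * (\<Sum>k<n. (corrector_move v k)\<^sup>2)"
    using sum_squared_le_sum_of_squares[of "corrector_move v" "{..<n}"] by (simp add: mult.commute)
  finally have "real n * (real n * ?e\<^sup>2) \<le> real n * (\<Sum>k<n. (corrector_move v k)\<^sup>2)"
    by (simp add: power2_eq_square mult_ac)
  hence "real n * ?e\<^sup>2 \<le> (\<Sum>k<n. (corrector_move v k)\<^sup>2)" using assms by simp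
  moreover have "(\<Sum>k<n. 3 * (corrector_move v k)\<^sup>2) \<le> (\<Sum>k<n. decrease v k)"
    by (intro sum_mono corrector_sq_le_decrease assms)
  ultimately show ?thesis by (simp add: sum_distrib_left[symmetric])
qed

text \<open>The tail hypothesis holds when the iterates contract linearly; it is what makes the distance
  between the two averages decay like \<open>1 / n\<close> rather than \<open>1 / sqrt n\<close>.\<close>

lemma avg_dist_half_avg_of_tails:
  assumes "v \<in> W" "1 \<le> n" "0 \<le> M" "\<And>k. k < n \<Longrightarrow> (\<Sum>j=k..<n. decrease v j) \<le> M * decrease v k"
  shows "3 * (real n * norm (avg v n - half_avg v n))\<^sup>2 \<le> 4 * M * (\<Sum>k<n. decrease v k)"
proof -
  let ?E = "\<Sum>k<n. decrease v k"
  have E: "0 \<le> ?E" by (intro sum_nonneg decrease_nonneg)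
  have "real n * norm (avg v n - half_avg v n) \<le> (\<Sum>k<n. corrector_move v k)"
    by (rule avg_dist_half_avg[OF assms(2)])
  also have "\<dots> \<le> (\<Sum>k<n. 1 / sqrt 3 * sqrt (decrease v k))"
  proof (intro sum_mono)
    fix k
    have "sqrt (3 * (corrector_move v k)\<^sup>2) \<le> sqrt (decrease v k)"
      by (intro real_sqrt_le_mono corrector_sq_le_decrease assms)
    thus "corrector_move v k \<le> 1 / sqrt 3 * sqrt (decrease v k)"
      by (simp add: real_sqrt_mult field_simps corrector_move_def)
  qed
  also have "\<dots> = 1 / sqrt 3 * (\<Sum>k<n. sqrt (decrease v k))" by (rule sum_distrib_left[symmetric])
  also have "\<dots> \<le> 1 / sqrt 3 * (2 * sqrt M * sqrt ?E)"
    using assms by (intro mult_left_mono sum_sqrt_le_of_tails decrease_nonneg) auto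
  finally have "(real n * norm (avg v n - half_avg v n))\<^sup>2 \<le> (1 / sqrt 3 * (2 * sqrt M * sqrt ?E))\<^sup>2"
    by (intro power_mono) auto
  also have "\<dots> = 4 / 3 * (M * ?E)" using E assms(3) by (simp add: power_mult_distrib power_divide)
  finally show ?thesis by simp
qed

end

subsection \<open>The gap in convex-concave problems\<close>

text \<open>On the segment from \<open>x\<close> to \<open>y\<close>, convexity bounds every
  difference quotient at \<open>x\<close> by \<open>\<phi> y - \<phi> x\<close>; then the step tends
  to 0. Only a derivative within \<open>S\<close> enters, so \<open>x\<close> may lie on the
  boundary.\<close>

lemma convex_on_above_tangent_within:
  fixes \<phi> :: "'a::real_normed_vector \<Rightarrow> real"
  assumes convex: "convex_on S \<phi>" and deriv: "(\<phi> has_derivative D) (at x within S)"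
    and x: "x \<in> S" and y: "y \<in> S"
  shows "\<phi> x + D (y - x) \<le> \<phi> y"
proof -
  let ?p = "\<lambda>t::real. x + t *\<^sub>R (y - x)"
  have S: "?p ` {0..1} \<subseteq> S"
    using convexD_alt[OF convex_on_imp_convex[OF convex] x y] by (auto simp: algebra_simps)
  interpret D: bounded_linear D using deriv by (rule has_derivative_bounded_linear)
  have "(?p has_derivative (\<lambda>t. t *\<^sub>R (y - x))) (at 0 within {0..1})"
    by (auto intro!: derivative_eq_intros)
  moreover have "(\<phi> has_derivative D) (at (?p 0) within ?p ` {0..1})"
    using has_derivative_subset[OF deriv S] by simp
  ultimately have "((\<lambda>t. \<phi> (?p t)) has_derivative (\<lambda>t. D (t *\<^sub>R (y - x)))) (at 0 within {0..1})"
    by (rule has_derivative_in_compose)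
  hence "((\<lambda>t. \<phi> (?p t)) has_field_derivative D (y - x)) (at 0 within {0..1})"
    unfolding has_field_derivative_def by (rule has_derivative_eq_rhs) (simp add: D.scaleR fun_eq_iff)
  hence "((\<lambda>t. (\<phi> (?p t) - \<phi> x) / t) \<longlongrightarrow> D (y - x)) (at 0 within {0..1})"
    by (simp add: has_field_derivative_iff)
  moreover have "\<forall>\<^sub>F t in at 0 within {0..1}. (\<phi> (?p t) - \<phi> x) / t \<le> \<phi> y - \<phi> x"
    unfolding eventually_at_filter
  proof (intro always_eventually allI impI)
    fix t :: real assume t: "t \<noteq> 0" "t \<in> {0..1}"
    have "\<phi> (?p t) \<le> (1 - t) * \<phi> x + t * \<phi> y"
      using convex_onD[OF convex, of t x y] t x y by (simp add: algebra_simps)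
    thus "(\<phi> (?p t) - \<phi> x) / t \<le> \<phi> y - \<phi> x" using t by (simp add: field_simps)
  qed
  moreover have "at 0 within {0..1::real} \<noteq> bot" by (simp add: at_within_Icc_at_right)
  ultimately have "D (y - x) \<le> \<phi> y - \<phi> x" by (intro tendsto_upperbound)
  thus ?thesis by simp
qed

locale convex_concave_problem =
  fixes X :: "'a::euclidean_space set" and Y :: "'b::euclidean_space set"
    and f :: "'a \<times> 'b \<Rightarrow> real" and G :: "'a \<times> 'b \<Rightarrow> 'a \<times> 'b" and L \<gamma> :: real
  assumes closed_X: "closed X" and convex_X: "convex X" and closed_Y: "closed Y" and convex_Y: "convex Y"
    and smooth: "smooth_with_gradient L (X \<times> Y) f G"
    and convex_fst: "\<And>y. y \<in> Y \<Longrightarrow> convex_on X (\<lambda>x. f (x, y))"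
    and concave_snd: "\<And>x. x \<in> X \<Longrightarrow> concave_on Y (\<lambda>y. f (x, y))"
    and L_pos: "0 < L" and gamma_pos: "0 < \<gamma>" and gamma_le: "\<gamma> \<le> 1 / L"
begin

sublocale extragradient_method "X \<times> Y" "saddle_operator G" \<gamma>
proof
  fix w w' assume w: "w \<in> X \<times> Y" "w' \<in> X \<times> Y"
  have "norm (saddle_operator G w - saddle_operator G w') = norm (G w - G w')"
    by (simp add: saddle_operator_def norm_prod_def norm_minus_commute)
  also have "\<dots> \<le> L * norm (w - w')" using smooth w unfolding smooth_with_gradient_def by blast
  finally have "\<gamma> * norm (saddle_operator G w - saddle_operator G w') \<le> \<gamma> * (L * norm (w - w'))"
    using gamma_pos by simp
  also have "\<gamma> * (L * norm (w - w')) = (\<gamma> * L) * norm (w - w')" by simp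
  also have "\<dots> \<le> 1 * norm (w - w')"
    using gamma_le L_pos by (intro mult_right_mono) (auto simp: field_simps)
  finally show "\<gamma> * norm (saddle_operator G w - saddle_operator G w') \<le> norm (w - w')" by simp
qed (use closed_X closed_Y convex_X convex_Y gamma_pos in \<open>auto intro: closed_Times convex_Times\<close>)

definition gap :: "'a \<times> 'b \<Rightarrow> 'a \<times> 'b \<Rightarrow> real" where
  "gap z w = f (fst z, snd w) - f (fst w, snd z)"

lemma gap_self [simp]: "gap z z = 0"
  by (simp add: gap_def)

lemma gap_swap: "gap w z = - gap z w"
  by (simp add: gap_def)

lemma local_gap_eq: "local_gap f (X \<times> Y) r z = (SUP w \<in> X \<times> Y \<inter> cball z r. gap z w)"
  by (simp add: local_gap_def gap_def case_prod_beta)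

text \<open>Add the tangent inequality of the convex slice to that of the concave slice; the value
  at \<open>z\<close> cancels, and the sign flip in \<open>saddle_operator\<close> matches the
  concave part.\<close>

lemma gap_le_operator:
  assumes z: "z \<in> X \<times> Y" and w: "w \<in> X \<times> Y"
  shows "gap z w \<le> saddle_operator G z \<bullet> (z - w)"
proof -
  obtain x y x' y' where eq: "z = (x, y)" "w = (x', y')" by (cases z, cases w)
  have mem: "x \<in> X" "x' \<in> X" "y \<in> Y" "y' \<in> Y" using z w by (auto simp: eq)
  have d: "(f has_derivative (\<lambda>h. G (x, y) \<bullet> h)) (at (x, y) within X \<times> Y)"
    using smooth z by (auto simp: smooth_with_gradient_def eq)
  \<comment> \<open>Chain rule along the embedding of the slice, with derivatives taken within the
    sets.\<close>
  have "((\<lambda>x. f (x, y)) has_derivative (\<lambda>h. G (x, y) \<bullet> (h, 0))) (at x within X)"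
    using mem by (intro has_derivative_in_compose[where f = "\<lambda>x. (x, y)" and g = f] has_derivative_subset[OF d])
      (auto intro!: derivative_eq_intros)
  from convex_on_above_tangent_within[OF convex_fst[OF mem(3)] this mem(1,2)]
  have 1: "f (x, y) + fst (G (x, y)) \<bullet> (x' - x) \<le> f (x', y)" by (simp add: inner_prod_def)
  have "((\<lambda>y. f (x, y)) has_derivative (\<lambda>h. G (x, y) \<bullet> (0, h))) (at y within Y)"
    using mem by (intro has_derivative_in_compose[where f = "\<lambda>y. (x, y)" and g = f] has_derivative_subset[OF d])
      (auto intro!: derivative_eq_intros)
  hence d2: "((\<lambda>y. - f (x, y)) has_derivative (\<lambda>h. - (G (x, y) \<bullet> (0, h)))) (at y within Y)"
    by (rule has_derivative_minus)
  have "convex_on Y (\<lambda>y. - f (x, y))" using concave_snd[OF mem(1)] by (simp add: concave_on_def)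
  from convex_on_above_tangent_within[OF this d2 mem(3,4)]
  have 2: "f (x, y') \<le> f (x, y) + snd (G (x, y)) \<bullet> (y' - y)" by (simp add: inner_prod_def)
  show ?thesis using 1 2
    by (simp add: eq gap_def saddle_operator_def inner_diff_right)
qed

text \<open>Apply the gap bound in both directions; the gaps cancel by antisymmetry.\<close>

lemma operator_monotone:
  assumes "w \<in> X \<times> Y" "w' \<in> X \<times> Y"
  shows "0 \<le> (saddle_operator G w - saddle_operator G w') \<bullet> (w - w')"
  using gap_le_operator[OF assms] gap_le_operator[OF assms(2,1)] gap_swap[of w w']
  by (simp add: inner_diff_left inner_diff_right)

lemma continuous_on_f: "continuous_on (X \<times> Y) f"
  using smooth unfolding smooth_with_gradient_def
  by (auto intro!: has_derivative_continuous_on)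

text \<open>Optimality holds for every positive radius, so a ball containing \<open>w\<close> may be
  chosen; the added 1 covers \<open>w = z\<close>. Compactness makes the real supremum an upper
  bound.\<close>

lemma gap_optimal_nonpos:
  assumes opt: "z \<in> optimal_set f (X \<times> Y)" and w: "w \<in> X \<times> Y"
  shows "gap z w \<le> 0"
proof -
  let ?r = "dist z w + 1"
  let ?K = "X \<times> Y \<inter> cball z ?r"
  have z: "z \<in> X \<times> Y" using opt by (simp add: optimal_set_def)
  have "continuous_on ?K (gap z)"
    unfolding gap_def using z
    by (intro continuous_intros continuous_on_compose2[OF continuous_on_f]) auto
  moreover have "compact ?K" using closed_W by (rule closed_Int_compact) simp
  ultimately have "bdd_above (gap z ` ?K)"
    by (intro bounded_imp_bdd_above compact_imp_bounded compact_continuous_image)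
  hence "gap z w \<le> (SUP w \<in> ?K. gap z w)" using w by (intro cSUP_upper) auto
  also have "\<dots> = local_gap f (X \<times> Y) ?r z" by (simp add: local_gap_eq)
  also have "\<dots> = 0"
  proof -
    have "0 < ?r" by (simp add: add_nonneg_pos)
    thus ?thesis using opt unfolding optimal_set_def by blast
  qed
  finally show ?thesis .
qed

text \<open>\<open>gap z\<close> is concave and vanishes at \<open>z\<close>. This transfers gap
  bounds from a small ball to a larger one.\<close>

lemma gap_concave_scaling:
  assumes z: "z \<in> X \<times> Y" and w: "w \<in> X \<times> Y" and t: "0 \<le> t" "t \<le> 1"
  shows "t * gap z w \<le> gap z (z + t *\<^sub>R (w - z))"
proof -
  obtain x y x' y' where eq: "z = (x, y)" "w = (x', y')" by (cases z, cases w)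
  have mem: "x \<in> X" "x' \<in> X" "y \<in> Y" "y' \<in> Y" using z w by (auto simp: eq)
  have "f (x + t *\<^sub>R (x' - x), y) \<le> (1 - t) * f (x, y) + t * f (x', y)"
    using convex_onD[OF convex_fst[OF mem(3)], of t x x'] mem t by (simp add: algebra_simps)
  moreover have "(1 - t) * f (x, y) + t * f (x, y') \<le> f (x, y + t *\<^sub>R (y' - y))"
    using concave_onD[OF concave_snd[OF mem(1)], of t y y'] mem t by (simp add: algebra_simps)
  ultimately show ?thesis by (simp add: eq gap_def algebra_simps)
qed

text \<open>Jensen's inequality, as the gap is convex in its first argument.\<close>

lemma gap_mean_le:
  assumes n: "1 \<le> n" and p: "\<And>k. k < n \<Longrightarrow> p k \<in> X \<times> Y" and w: "w \<in> X \<times> Y"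
  shows "real n * gap ((1 / real n) *\<^sub>R (\<Sum>k<n. p k)) w \<le> (\<Sum>k<n. gap (p k) w)"
proof -
  obtain x y where eq: "w = (x, y)" and mem: "x \<in> X" "y \<in> Y" using w by auto
  have p': "fst (p k) \<in> X" "snd (p k) \<in> Y" if "k < n" for k using p[OF that] by auto
  let ?m = "(1 / real n) *\<^sub>R (\<Sum>k<n. p k)"
  have ne: "{..<n} \<noteq> {}" using n by (auto simp: lessThan_empty_iff)
  have "f (\<Sum>k<n. (1 / real n) *\<^sub>R fst (p k), y) \<le> (\<Sum>k<n. (1 / real n) * f (fst (p k), y))"
    using n mem p' by (intro convex_on_sum[OF _ ne convex_fst[OF mem(2)]]) auto
  hence 1: "f (fst ?m, y) \<le> (\<Sum>k<n. (1 / real n) * f (fst (p k), y))"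
    by (simp add: scaleR_right.sum fst_sum)
  have "(\<Sum>k<n. (1 / real n) * f (x, snd (p k))) \<le> f (x, \<Sum>k<n. (1 / real n) *\<^sub>R snd (p k))"
    using n mem p' by (intro concave_on_sum[OF _ ne concave_snd[OF mem(1)]]) auto
  hence 2: "(\<Sum>k<n. (1 / real n) * f (x, snd (p k))) \<le> f (x, snd ?m)"
    by (simp add: scaleR_right.sum snd_sum)
  have "gap ?m w \<le> (1 / real n) * (\<Sum>k<n. gap (p k) w)"
    using 1 2 by (simp add: gap_def eq sum_subtractf sum_divide_distrib diff_divide_distrib)
  thus ?thesis using n by (simp add: field_simps)
qed

lemma gap_half_avg_le:
  assumes v: "v \<in> X \<times> Y" and w: "w \<in> X \<times> Y" and n: "1 \<le> n"
  shows "\<gamma> * real n * gap (half_avg v n) w \<le> (norm (v - w))\<^sup>2 - (\<Sum>k<n. decrease v k)"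
proof -
  have "real n * gap (half_avg v n) w \<le> (\<Sum>k<n. gap (half_iter v k) w)"
    unfolding half_avg_def using n v w by (intro gap_mean_le half_iter_in)
  also have "\<dots> \<le> (\<Sum>k<n. saddle_operator G (half_iter v k) \<bullet> (half_iter v k - w))"
    using v w by (intro sum_mono gap_le_operator half_iter_in)
  finally have "\<gamma> * (real n * gap (half_avg v n) w)
      \<le> \<gamma> * (\<Sum>k<n. saddle_operator G (half_iter v k) \<bullet> (half_iter v k - w))"
    using gamma_pos by simp
  also have "\<dots> \<le> (norm (v - w))\<^sup>2 - (norm (iter v n - w))\<^sup>2 - (\<Sum>k<n. decrease v k)"
    by (rule sum_iteration_inequality[OF v w])
  also have "\<dots> \<le> (norm (v - w))\<^sup>2 - (\<Sum>k<n. decrease v k)" by simp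
  finally show ?thesis by (simp add: mult.assoc)
qed

text \<open>The optimality condition of the predictor step; monotonicity lets the two residual terms
  combine with constant \<open>sqrt 5 < 56 / 25\<close> instead of \<open>3\<close>.\<close>

lemma gap_half_iter_le:
  assumes v: "v \<in> X \<times> Y" and w: "w \<in> X \<times> Y"
  shows "\<gamma> * gap (half_iter v k) w \<le> 56 / 25 * predictor_move v k * norm (half_iter v k - w)"
proof -
  let ?u = "iter v k" and ?z = "half_iter v k" and ?g = "saddle_operator G"
  have u: "?u \<in> X \<times> Y" and z: "?z \<in> X \<times> Y" using v by (auto intro: iter_in half_iter_in)
  define \<eta> where "\<eta> = \<gamma> *\<^sub>R (?g ?u - ?g ?z)"
  have lip: "norm \<eta> \<le> norm (?u - ?z)" using lipschitz[OF u z] gamma_pos by (simp add: \<eta>_def)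
  have mono: "0 \<le> \<eta> \<bullet> (?u - ?z)"
    using operator_monotone[OF u z] gamma_pos by (simp add: \<eta>_def)
  have "(norm (2 *\<^sub>R (?u - ?z) - \<eta>))\<^sup>2 = 4 * (norm (?u - ?z))\<^sup>2 - 4 * (\<eta> \<bullet> (?u - ?z)) + (norm \<eta>)\<^sup>2"
    unfolding power2_norm_eq_inner by (simp add: inner_simps inner_commute algebra_simps)
  also have "\<dots> \<le> 5 * (norm (?u - ?z))\<^sup>2" using mono power_mono[OF lip norm_ge_zero, of 2] by linarith
  also have "\<dots> \<le> (56 / 25 * norm (?u - ?z))\<^sup>2" unfolding power_mult_distrib
    by (intro mult_right_mono) (auto simp: power2_eq_square)
  finally have res: "norm (2 *\<^sub>R (?u - ?z) - \<eta>) \<le> 56 / 25 * norm (?u - ?z)"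
    by (rule power2_le_imp_le) simp
  have "\<gamma> * gap ?z w \<le> \<gamma> * (?g ?z \<bullet> (?z - w))" using gap_le_operator[OF z w] gamma_pos by simp
  also have "\<dots> = \<gamma> * (?g ?u \<bullet> (?z - w)) - \<eta> \<bullet> (?z - w)"
    by (simp add: \<eta>_def inner_diff_left right_diff_distrib)
  also have "\<dots> \<le> 2 * ((?u - ?z) \<bullet> (?z - w)) - \<eta> \<bullet> (?z - w)"
    using prox_step_dot[OF w, of "?g ?u" ?u] by (simp flip: half_iter_def)
  also have "\<dots> = (2 *\<^sub>R (?u - ?z) - \<eta>) \<bullet> (?z - w)" by (simp add: inner_diff_left)
  also have "\<dots> \<le> norm (2 *\<^sub>R (?u - ?z) - \<eta>) * norm (?z - w)" by (rule norm_cauchy_schwarz)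
  also have "\<dots> \<le> 56 / 25 * norm (?u - ?z) * norm (?z - w)" using res by (intro mult_right_mono) auto
  finally show ?thesis by (simp add: predictor_move_def norm_minus_commute)
qed

end

subsection \<open>Distance to the optimal set after one epoch\<close>

text \<open>Here \<open>q\<close> is \<open>\<gamma> * \<theta>\<close>, \<open>rz\<close> the
  distance of the predictor average to the optimal set, \<open>e\<close> the distance between the
  averages, \<open>D\<close> and \<open>Dz\<close> their displacements from the start, and
  \<open>E\<close> the total decrease. For \<open>q * t \<le> 1\<close> the ball of radius
  \<open>rz\<close> gives no bound on \<open>rz\<close>; the ball of radius \<open>Dz / 2\<close>
  gives one linear in \<open>rz\<close>.\<close>

lemma small_regime:
  fixes q t rz e D Dz E :: real
  assumes q: "0 < q" "q \<le> 1" and t: "1 \<le> t" "t = 1 \<or> 2 \<le> t"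
    and nn: "0 \<le> rz" "0 \<le> e" "0 \<le> Dz"
    and dist: "Dz \<le> D + e"
    and E: "3 * t * e\<^sup>2 \<le> E"
    and center: "E \<le> Dz\<^sup>2"
    and scaled: "\<And>\<delta>. 0 < \<delta> \<Longrightarrow> \<delta> \<le> rz \<Longrightarrow> q * t * rz * \<delta> \<le> (\<delta> + Dz)\<^sup>2 - E"
    and s: "q * t \<le> 9 / 4"
  shows "q * t * (rz + e) \<le> 8 * D"
proof -
  have "1 * e\<^sup>2 \<le> t * e\<^sup>2" using t by (intro mult_right_mono) auto
  hence e3: "3 * e\<^sup>2 \<le> Dz\<^sup>2" using E center by simp
  \<comment> \<open>29/50 lies just above 1 / sqrt 3.\<close>
  have e58: "e \<le> 29 / 50 * Dz"
  proof (rule power2_le_imp_le)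
    have "(29 / 50 * Dz)\<^sup>2 = 841 / 2500 * Dz\<^sup>2" by (simp add: power_mult_distrib power_divide)
    thus "e\<^sup>2 \<le> (29 / 50 * Dz)\<^sup>2" using e3 zero_le_power2[of Dz] by linarith
  qed (use nn in auto)
  have qt: "0 < q * t" using q t by simp
  show ?thesis
  proof (cases "rz < Dz / 2 \<or> rz = 0")
    case True
    hence "rz \<le> Dz / 2" using nn by auto
    hence "q * t * (rz + e) \<le> 9 / 4 * (Dz / 2 + e)"
      using s nn qt by (intro mult_mono) auto
    also have "\<dots> \<le> 8 * (Dz - e)" using e58 nn(3) by (simp add: field_simps)
    also have "\<dots> \<le> 8 * D" using dist by simp
    finally show ?thesis .
  next
    case False
    hence rz: "Dz / 2 \<le> rz" "0 < rz" using nn by auto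
    show ?thesis
    proof (cases "Dz = 0")
      case True
      \<comment> \<open>This case is contradictory: the radius \<open>?d\<close> would give
        \<open>3 * ?d\<^sup>2 \<le> ?d\<^sup>2\<close>. Division by 3 keeps \<open>?d\<close> below
        \<open>rz\<close>.\<close>
      let ?d = "q * t * rz / 3"
      have "?d \<le> rz" using s rz by (simp add: mult_right_mono)
      hence "q * t * rz * ?d \<le> ?d\<^sup>2 - E" using scaled[of ?d] True rz qt by simp
      moreover have "0 \<le> E" using E t by (smt (verit) mult_nonneg_nonneg zero_le_power2)
      ultimately have "q * t * rz * ?d \<le> ?d\<^sup>2" by simp
      hence "3 * ?d\<^sup>2 \<le> ?d\<^sup>2" by (simp add: power2_eq_square)
      hence "?d\<^sup>2 \<le> 0" by simp
      thus ?thesis using rz qt by auto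
    next
      case False
      hence Dz: "0 < Dz" using nn by simp
      have "q * t * rz * (Dz / 2) \<le> (Dz / 2 + Dz)\<^sup>2 - E" using scaled[of "Dz / 2"] rz Dz by simp
      hence A: "q * t * rz * Dz \<le> 9 / 2 * Dz\<^sup>2 - 6 * t * e\<^sup>2" using E by (simp add: power2_eq_square algebra_simps)
      \<comment> \<open>After multiplication by \<open>Dz\<close>, the claim reduces through
        \<open>A\<close> to \<open>(8 + q * t) * e * Dz \<le> 7 / 2 * Dz\<^sup>2 + 6 * t *
        e\<^sup>2\<close>. Its discriminant condition is \<open>k\<close>.\<close>
      have k: "(8 + q * t)\<^sup>2 \<le> 84 * t"
        using t(2)
      proof
        assume "t = 1"
        hence "(8 + q * t)\<^sup>2 \<le> 9\<^sup>2" using q by (intro power_mono) auto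
        thus ?thesis using \<open>t = 1\<close> by simp
      next
        assume "2 \<le> t"
        have "(8 + q * t)\<^sup>2 \<le> (41 / 4)\<^sup>2" using qt s by (intro power_mono) auto
        thus ?thesis using \<open>2 \<le> t\<close> by (simp add: power2_eq_square)
      qed
      have "0 \<le> (7 * Dz - (8 + q * t) * e)\<^sup>2" by simp
      also have "\<dots> = 49 * Dz\<^sup>2 - 14 * (8 + q * t) * e * Dz + (8 + q * t)\<^sup>2 * e\<^sup>2"
        by (simp add: power2_eq_square algebra_simps)
      also have "\<dots> \<le> 49 * Dz\<^sup>2 - 14 * (8 + q * t) * e * Dz + 84 * t * e\<^sup>2"
        using k by (simp add: mult_right_mono)
      finally have "(8 + q * t) * e * Dz \<le> 7 / 2 * Dz\<^sup>2 + 6 * t * e\<^sup>2" by (simp add: algebra_simps)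
      hence "(q * t * (rz + e)) * Dz \<le> (8 * (Dz - e)) * Dz"
        using A by (simp add: power2_eq_square algebra_simps)
      hence "q * t * (rz + e) \<le> 8 * (Dz - e)" using Dz by simp
      thus ?thesis using dist by simp
    qed
  qed
qed

text \<open>For moderate \<open>x = sqrt (q * t)\<close> the first bound on \<open>e\<close>
  suffices and yields \<open>mid\<close>. Its slope is below 1, so for \<open>x > 7\<close> the
  second bound on \<open>e\<close> takes over.\<close>

lemma averaged_regime:
  fixes q t rz e D Dz E :: real
  assumes q: "0 < q" "q \<le> 1" and t: "1 \<le> t" "t = 1 \<or> 2 \<le> t"
    and nn: "0 \<le> rz" "0 \<le> e" "0 \<le> D" "0 \<le> Dz"
    and dist: "Dz \<le> D + e"
    and E: "3 * t * e\<^sup>2 \<le> E" "(q * t)\<^sup>2 * e\<^sup>2 \<le> 15 * E"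
    and center: "E \<le> Dz\<^sup>2"
    and growth: "q * t * rz\<^sup>2 \<le> (rz + Dz)\<^sup>2 - E"
    and scaled: "\<And>\<delta>. 0 < \<delta> \<Longrightarrow> \<delta> \<le> rz \<Longrightarrow> q * t * rz * \<delta> \<le> (\<delta> + Dz)\<^sup>2 - E"
  shows "q * t \<le> 16 \<Longrightarrow> q * t * (rz + e) \<le> 8 * D"
    and "16 \<le> q * t \<Longrightarrow> (sqrt (q * t) - 2) * (rz + e) \<le> D"
proof -
  define R where "R = rz + e"
  define x where "x = sqrt (q * t)"
  have qt: "0 < q * t" using q t by simp
  have x: "0 < x" "x\<^sup>2 = q * t" using qt by (auto simp: x_def)
  have R: "0 \<le> R" using nn by (simp add: R_def)
  have RD: "(rz + Dz)\<^sup>2 \<le> (R + D)\<^sup>2" using dist nn by (intro power_mono) (auto simp: R_def)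
  have qtt: "q * t \<le> t" using q t by (simp add: mult_left_le_one_le)
  have "q * t * (3 * e\<^sup>2) \<le> t * (3 * e\<^sup>2)" using qtt by (intro mult_right_mono) auto
  hence "q * t * (rz\<^sup>2 + 3 * e\<^sup>2) \<le> (R + D)\<^sup>2" using RD growth E(1) by (simp add: algebra_simps)
  moreover have "3 / 4 * R\<^sup>2 \<le> rz\<^sup>2 + 3 * e\<^sup>2"
    using zero_le_power2[of "rz - 3 * e"] by (simp add: R_def power2_eq_square algebra_simps)
  hence "q * t * (3 / 4 * R\<^sup>2) \<le> q * t * (rz\<^sup>2 + 3 * e\<^sup>2)" using qt by (intro mult_left_mono) auto
  ultimately have "x\<^sup>2 * (3 / 4 * R\<^sup>2) \<le> (R + D)\<^sup>2" using x by simp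
  \<comment> \<open>433/500 lies just below sqrt 3 / 2.\<close>
  moreover have "(433 / 500 * x * R)\<^sup>2 = 187489 / 250000 * (x * R)\<^sup>2" "x\<^sup>2 * (3 / 4 * R\<^sup>2) = 3 / 4 * (x * R)\<^sup>2"
    by (simp_all add: power_mult_distrib power_divide)
  ultimately have "(433 / 500 * x * R)\<^sup>2 \<le> (R + D)\<^sup>2"
    using zero_le_power2[of "x * R"] by linarith
  hence mid: "433 / 500 * x * R \<le> R + D" by (rule power2_le_imp_le) (use R nn in auto)
  show "q * t * (rz + e) \<le> 8 * D" if s: "q * t \<le> 16"
  proof (cases "x \<le> 3 / 2")
    case True
    hence "x\<^sup>2 \<le> (3 / 2)\<^sup>2" using x by (intro power_mono) auto
    hence "q * t \<le> 9 / 4" using x by (simp add: power2_eq_square)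
    thus ?thesis using small_regime[of q t rz e Dz D E] assms by blast
  next
    case False
    have "x\<^sup>2 \<le> 4\<^sup>2" using s x by simp
    hence "x \<le> 4" by (rule power2_le_imp_le) simp
    \<comment> \<open>On [3/2, 4] the square of \<open>x\<close> lies below its chord, which lies
      below \<open>8 * (433 / 500 * x - 1)\<close>.\<close>
    hence "0 \<le> (2 * x - 3) * (4 - x)" using False by simp
    hence "2 * x\<^sup>2 \<le> 11 * x - 12" by (simp add: power2_eq_square algebra_simps)
    hence "x\<^sup>2 \<le> 8 * (433 / 500 * x - 1)" using False by simp
    hence "x\<^sup>2 * R \<le> 8 * (433 / 500 * x - 1) * R" using R by (intro mult_right_mono)
    also have "\<dots> \<le> 8 * D" using mid by (simp add: algebra_simps)
    finally show ?thesis using x by (simp add: R_def)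
  qed
  show "(sqrt (q * t) - 2) * (rz + e) \<le> D" if s: "16 \<le> q * t"
  proof (cases "x \<le> 7")
    case True
    have "(x - 1) * R \<le> 433 / 500 * x * R" using True R by (intro mult_right_mono) auto
    thus ?thesis using mid by (simp add: R_def x_def algebra_simps)
  next
    case False
    have E0: "0 \<le> E" using E by (smt (verit) mult_nonneg_nonneg zero_le_power2 t(1))
    have "x\<^sup>2 * rz\<^sup>2 \<le> (R + D)\<^sup>2 - E" using RD growth x by simp
    moreover have x4: "x ^ 4 * e\<^sup>2 \<le> 15 * E" using E(2) x(2) by (metis (no_types) mult_2 numeral_Bit0 power_add power2_eq_square)
    ultimately have "15 * (x\<^sup>2 * rz\<^sup>2) + x ^ 4 * e\<^sup>2 \<le> 15 * (R + D)\<^sup>2" by simp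
    hence A: "(x\<^sup>2 + 15) * (15 * (x\<^sup>2 * rz\<^sup>2) + x ^ 4 * e\<^sup>2) \<le> (x\<^sup>2 + 15) * (15 * (R + D)\<^sup>2)"
      by (intro mult_left_mono) auto
    \<comment> \<open>The slack in a weighted Cauchy-Schwarz inequality for
      \<open>R = rz + e\<close>.\<close>
    have "0 \<le> x\<^sup>2 * (15 * rz - x\<^sup>2 * e)\<^sup>2" by simp
    also have "\<dots> = (x\<^sup>2 + 15) * (15 * (x\<^sup>2 * rz\<^sup>2) + x ^ 4 * e\<^sup>2) - 15 * x ^ 4 * R\<^sup>2"
      by (simp add: R_def power2_eq_square power4_eq_xxxx algebra_simps)
    finally have B: "x ^ 4 * R\<^sup>2 \<le> (x\<^sup>2 + 15) * (R + D)\<^sup>2" using A by simp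
    \<comment> \<open>The cubic that remains after expanding the next inequality, factored at 7 up
      to a constant in its favour.\<close>
    have "0 \<le> (x - 7) * (2 * x\<^sup>2 - 2 * x + 16)"
      using False zero_le_power2[of "x - 1"] zero_le_power2[of x] by (intro mult_nonneg_nonneg) (auto simp: power2_eq_square algebra_simps)
    hence "(x\<^sup>2 + 15) * (x - 1)\<^sup>2 \<le> x ^ 4"
      using False by (simp add: power2_eq_square power4_eq_xxxx algebra_simps)
    hence "(x\<^sup>2 + 15) * (x - 1)\<^sup>2 * R\<^sup>2 \<le> x ^ 4 * R\<^sup>2" by (intro mult_right_mono) auto
    with B have "(x\<^sup>2 + 15) * ((x - 1) * R)\<^sup>2 \<le> (x\<^sup>2 + 15) * (R + D)\<^sup>2" by (simp add: power_mult_distrib mult.assoc)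
    moreover have "0 < x\<^sup>2 + 15" by (smt (verit) zero_le_power2)
    ultimately have "((x - 1) * R)\<^sup>2 \<le> (R + D)\<^sup>2" by simp
    hence "(x - 1) * R \<le> R + D" by (rule power2_le_imp_le) (use R nn in auto)
    thus ?thesis by (simp add: R_def x_def algebra_simps)
  qed
qed

section \<open>Consequences of quadratic growth\<close>

locale quadratic_growth_problem = convex_concave_problem X Y f G L \<gamma>
  for X :: "'a::euclidean_space set" and Y :: "'b::euclidean_space set" and f G L \<gamma> +
  fixes \<theta> :: real
  assumes theta_pos: "0 < \<theta>" and theta_le: "\<theta> \<le> L"
    and optimal_nonempty: "optimal_set f (X \<times> Y) \<noteq> {}"
    and growth: "\<And>w. w \<in> X \<times> Y \<Longrightarrow>
      \<theta> * (infdist w (optimal_set f (X \<times> Y)))\<^sup>2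
        \<le> local_gap f (X \<times> Y) (infdist w (optimal_set f (X \<times> Y))) w"
begin

abbreviation opt_dist :: "'a \<times> 'b \<Rightarrow> real" where
  "opt_dist w \<equiv> infdist w (optimal_set f (X \<times> Y))"

text \<open>Estimates proved against every optimal point pass to the infimum, so no nearest optimal
  point has to be chosen.\<close>

lemma opt_dist_greatest:
  assumes "\<And>w. w \<in> optimal_set f (X \<times> Y) \<Longrightarrow> B \<le> norm (z - w)"
  shows "B \<le> opt_dist z"
  unfolding infdist_notempty[OF optimal_nonempty] using assms optimal_nonempty
  by (intro cINF_greatest) (auto simp: dist_norm)

lemma rate_pos: "0 < \<gamma> * \<theta>"
  using gamma_pos theta_pos by simp

lemma rate_le_1: "\<gamma> * \<theta> \<le> 1"
proof -
  have "\<gamma> * \<theta> \<le> 1 / L * L" using gamma_pos theta_pos gamma_le theta_le L_pos by (intro mult_mono) auto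
  thus ?thesis using L_pos by simp
qed

lemma growth_le:
  assumes z: "z \<in> X \<times> Y" and B: "\<And>w. w \<in> X \<times> Y \<Longrightarrow> norm (w - z) \<le> opt_dist z \<Longrightarrow> gap z w \<le> B"
  shows "\<theta> * (opt_dist z)\<^sup>2 \<le> B"
proof -
  have "local_gap f (X \<times> Y) (opt_dist z) z \<le> B"
    unfolding local_gap_eq using z B
    by (intro cSUP_least) (auto simp: infdist_nonneg dist_norm norm_minus_commute)
  thus ?thesis using growth[OF z] by simp
qed

text \<open>At an optimal \<open>w\<close> the gap of the predictor is nonnegative, hence so is the
  operator term of \<open>iteration_inequality\<close>.\<close>

lemma iter_fejer:
  assumes v: "v \<in> X \<times> Y" and w: "w \<in> optimal_set f (X \<times> Y)"
  shows "(norm (iter v (Suc k) - w))\<^sup>2 + decrease v k \<le> (norm (iter v k - w))\<^sup>2"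
proof -
  have wW: "w \<in> X \<times> Y" using w by (simp add: optimal_set_def)
  have "0 \<le> gap (half_iter v k) w"
    using gap_optimal_nonpos[OF w half_iter_in[OF v], of k] gap_swap[of w "half_iter v k"] by simp
  also have "\<dots> \<le> saddle_operator G (half_iter v k) \<bullet> (half_iter v k - w)"
    by (rule gap_le_operator[OF half_iter_in[OF v] wW])
  finally have "0 \<le> \<gamma> * (saddle_operator G (half_iter v k) \<bullet> (half_iter v k - w))"
    using gamma_pos by simp
  thus ?thesis using iteration_inequality[OF v wW, of k] by simp
qed

lemma iter_nonexpansive:
  assumes "v \<in> X \<times> Y" "w \<in> optimal_set f (X \<times> Y)"
  shows "norm (iter v k - w) \<le> norm (v - w)"
proof (induction k)
  case (Suc k)
  have "(norm (iter v (Suc k) - w))\<^sup>2 \<le> (norm (iter v k - w))\<^sup>2"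
    using iter_fejer[OF assms, of k] decrease_nonneg[of v k] by linarith
  hence "norm (iter v (Suc k) - w) \<le> norm (iter v k - w)" by (rule power2_le_imp_le) simp
  with Suc show ?case by simp
qed simp

text \<open>No iterate is farther from an optimal point than \<open>v\<close> is, so each lies
  within twice that distance of \<open>v\<close>. This is what makes the next restart criterion
  attainable.\<close>

lemma avg_move_le:
  assumes v: "v \<in> X \<times> Y" and n: "1 \<le> n"
  shows "norm (avg v n - v) \<le> 2 * opt_dist v"
proof -
  have "norm (avg v n - v) / 2 \<le> opt_dist v"
  proof (rule opt_dist_greatest)
    fix w assume w: "w \<in> optimal_set f (X \<times> Y)"
    have "norm (iter v k - v) \<le> 2 * norm (v - w)" for k
      using iter_nonexpansive[OF v w, of k] norm_triangle_ineq4[of "iter v k - w" "v - w"] by simp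
    hence "norm (\<Sum>k<n. iter v (Suc k) - v) \<le> real (card {..<n}) * (2 * norm (v - w))"
      by (intro sum_norm_bound)
    moreover have "(\<Sum>k<n. iter v (Suc k) - v) = real n *\<^sub>R (avg v n - v)"
      using n by (simp add: avg_eq sum_subtractf scaleR_right_diff_distrib scaleR_left.sum sum_constant_scaleR)
    ultimately have "real n * norm (avg v n - v) \<le> real n * (2 * norm (v - w))" by simp
    thus "norm (avg v n - v) / 2 \<le> norm (v - w)" using n by simp
  qed
  thus ?thesis by simp
qed

text \<open>The gap on the ball grows linearly in its radius while growth is quadratic, so one
  factor \<open>opt_dist\<close> cancels. The corrector adds at most half a predictor move: 56/25 +
  1/2 = 137/50.\<close>

lemma opt_dist_iter_le:
  assumes v: "v \<in> X \<times> Y"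
  shows "\<gamma> * \<theta> * opt_dist (iter v (Suc k)) \<le> 137 / 50 * predictor_move v k"
proof -
  let ?z = "half_iter v k" and ?a = "predictor_move v k"
  have a: "0 \<le> ?a" by (simp add: predictor_move_def)
  have "\<theta> * (opt_dist ?z)\<^sup>2 \<le> 56 / 25 * ?a * opt_dist ?z / \<gamma>"
  proof (rule growth_le[OF half_iter_in[OF v]])
    fix w assume w: "w \<in> X \<times> Y" "norm (w - ?z) \<le> opt_dist ?z"
    have "\<gamma> * gap ?z w \<le> 56 / 25 * ?a * norm (?z - w)" by (rule gap_half_iter_le[OF v w(1)])
    also have "\<dots> \<le> 56 / 25 * ?a * opt_dist ?z"
      using w(2) a by (intro mult_left_mono) (auto simp: norm_minus_commute)
    finally show "gap ?z w \<le> 56 / 25 * ?a * opt_dist ?z / \<gamma>" using gamma_pos by (simp add: field_simps)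
  qed
  hence "(\<gamma> * \<theta> * opt_dist ?z) * opt_dist ?z \<le> 56 / 25 * ?a * opt_dist ?z"
    using gamma_pos by (simp add: field_simps power2_eq_square)
  hence z: "\<gamma> * \<theta> * opt_dist ?z \<le> 56 / 25 * ?a"
    using infdist_nonneg[of ?z "optimal_set f (X \<times> Y)"] a
    by (cases "opt_dist ?z = 0") (auto simp: mult_le_cancel_right)
  have "opt_dist (iter v (Suc k)) \<le> opt_dist ?z + corrector_move v k"
    using infdist_triangle[of "iter v (Suc k)" "optimal_set f (X \<times> Y)" ?z]
    by (simp add: corrector_move_def dist_norm)
  hence "\<gamma> * \<theta> * opt_dist (iter v (Suc k)) \<le> \<gamma> * \<theta> * opt_dist ?z + \<gamma> * \<theta> * corrector_move v k"
    unfolding distrib_left[symmetric] by (intro mult_left_mono less_imp_le[OF rate_pos])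
  moreover have "\<gamma> * \<theta> * corrector_move v k \<le> 1 * corrector_move v k"
    using rate_le_1 by (intro mult_right_mono) (auto simp: corrector_move_def)
  ultimately show ?thesis using z corrector_le_predictor[OF v, of k] by simp
qed

text \<open>All decrease after step \<open>k\<close> is at most the squared distance to the optimal
  set at u^(k+1), which step \<open>k\<close> itself controls. Here (137/50)^2 * 4/3 is below 10.02,
  and \<open>decrease v k\<close> adds 1 because \<open>\<gamma> * \<theta> \<le> 1\<close>.\<close>

lemma decrease_tail_le:
  assumes v: "v \<in> X \<times> Y" and k: "k < n"
  shows "(\<Sum>j=k..<n. decrease v j) \<le> 1102 / 100 / (\<gamma> * \<theta>)\<^sup>2 * decrease v k"
proof -
  let ?q = "\<gamma> * \<theta>"
  have fejer: "(norm (iter v m - w))\<^sup>2 + (\<Sum>j=Suc k..<m. decrease v j) \<le> (norm (iter v (Suc k) - w))\<^sup>2"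
    if "Suc k \<le> m" "w \<in> optimal_set f (X \<times> Y)" for m w
    using that(1)
  proof (induction m rule: dec_induct)
    case (step m)
    thus ?case using iter_fejer[OF v that(2), of m] by simp
  qed simp
  let ?S = "\<Sum>j=Suc k..<n. decrease v j"
  have S0: "0 \<le> ?S" by (intro sum_nonneg decrease_nonneg)
  have "sqrt ?S \<le> opt_dist (iter v (Suc k))"
  proof (rule opt_dist_greatest)
    fix w assume "w \<in> optimal_set f (X \<times> Y)"
    hence "?S \<le> (norm (iter v (Suc k) - w))\<^sup>2"
      using fejer[of n w] k by (smt (verit) Suc_leI zero_le_power2)
    thus "sqrt ?S \<le> norm (iter v (Suc k) - w)" by (rule real_le_lsqrt[OF norm_ge_zero])
  qed
  hence "?q * sqrt ?S \<le> 137 / 50 * predictor_move v k"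
    using opt_dist_iter_le[OF v, of k] rate_pos by (smt (verit) mult_left_mono)
  hence "(?q * sqrt ?S)\<^sup>2 \<le> (137 / 50 * predictor_move v k)\<^sup>2"
    using rate_pos S0 by (intro power_mono) auto
  hence "?q\<^sup>2 * ?S \<le> 18769 / 2500 * (predictor_move v k)\<^sup>2"
    using S0 by (simp add: power_mult_distrib power_divide)
  also have "\<dots> \<le> 1002 / 100 * decrease v k"
    using predictor_sq_le_decrease[of v k] zero_le_power2[of "predictor_move v k"] by linarith
  finally have 1: "?q\<^sup>2 * ?S \<le> 1002 / 100 * decrease v k" .
  have "?q\<^sup>2 \<le> 1" using rate_pos rate_le_1 by (simp add: power_le_one)
  hence "?q\<^sup>2 * decrease v k \<le> 1 * decrease v k" by (intro mult_right_mono decrease_nonneg)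
  moreover have "(\<Sum>j=k..<n. decrease v j) = decrease v k + ?S"
    using k by (rule sum.atLeast_Suc_lessThan)
  ultimately have "?q\<^sup>2 * (\<Sum>j=k..<n. decrease v j) \<le> 1102 / 100 * decrease v k"
    using 1 by (simp add: distrib_left)
  thus ?thesis using gamma_pos theta_pos by (simp add: field_simps)
qed

lemma epoch_opt_dist_le:
  assumes v: "v \<in> X \<times> Y" and n: "1 \<le> n"
  defines "s \<equiv> \<gamma> * \<theta> * real n"
  shows "s \<le> 16 \<Longrightarrow> s * opt_dist (avg v n) \<le> 8 * norm (avg v n - v)"
    and "16 \<le> s \<Longrightarrow> (sqrt s - 2) * opt_dist (avg v n) \<le> norm (avg v n - v)"
proof -
  define z where "z = half_avg v n"
  define e where "e = norm (avg v n - z)"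
  define E where "E = (\<Sum>k<n. decrease v k)"
  define Dz where "Dz = norm (z - v)"
  define D where "D = norm (avg v n - v)"
  define r where "r = opt_dist z"
  have z: "z \<in> X \<times> Y" unfolding z_def using v n by (rule half_avg_in)
  have s: "0 < s" using rate_pos n by (simp add: s_def)
  have nn: "0 \<le> r" "0 \<le> e" "0 \<le> D" "0 \<le> Dz"
    by (auto simp: r_def e_def D_def Dz_def infdist_nonneg)
  have gap_ball: "\<gamma> * real n * gap z w \<le> (\<delta> + Dz)\<^sup>2 - E" if "w \<in> X \<times> Y" "norm (w - z) \<le> \<delta>" for w \<delta>
  proof -
    have "norm (v - w) \<le> \<delta> + Dz"
      using that(2) norm_triangle_ineq4[of "z - w" "z - v"] by (simp add: Dz_def norm_minus_commute)
    hence "(norm (v - w))\<^sup>2 \<le> (\<delta> + Dz)\<^sup>2" by (intro power_mono) auto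
    thus ?thesis using gap_half_avg_le[OF v that(1) n] by (simp add: z_def E_def)
  qed
  have growth': "\<theta> * r\<^sup>2 \<le> B / (\<gamma> * real n)"
    if "\<And>w. w \<in> X \<times> Y \<Longrightarrow> norm (w - z) \<le> r \<Longrightarrow> \<gamma> * real n * gap z w \<le> B" for B
    unfolding r_def using gamma_pos n that
    by (intro growth_le z) (simp add: r_def pos_le_divide_eq mult.commute mult.left_commute)
  have sr: "s * r\<^sup>2 \<le> B" if "\<theta> * r\<^sup>2 \<le> B / (\<gamma> * real n)" for B
    using that gamma_pos n by (simp add: s_def pos_le_divide_eq mult_ac)
  have dist: "Dz \<le> D + e"
    using norm_triangle_ineq4[of "avg v n - v" "avg v n - z"] by (simp add: Dz_def D_def e_def)
  have E1: "3 * real n * e\<^sup>2 \<le> E"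
    unfolding e_def z_def E_def by (rule avg_dist_half_avg_sq[OF v n])
  have E0: "0 \<le> E" unfolding E_def by (intro sum_nonneg decrease_nonneg)
  have "3 * (real n * e)\<^sup>2 \<le> 4 * (1102 / 100 / (\<gamma> * \<theta>)\<^sup>2) * E"
    unfolding e_def z_def E_def
    by (rule avg_dist_half_avg_of_tails[OF v n _ decrease_tail_le[OF v]]) auto
  hence "(\<gamma> * \<theta>)\<^sup>2 * (3 * (real n * e)\<^sup>2) \<le> (\<gamma> * \<theta>)\<^sup>2 * (4 * (1102 / 100 / (\<gamma> * \<theta>)\<^sup>2) * E)"
    by (intro mult_left_mono) auto
  also have "\<dots> = 4 * (1102 / 100) * E" using gamma_pos theta_pos by simp
  \<comment> \<open>4 * 11.02 / 3 is below 15.\<close>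
  finally have E2: "s\<^sup>2 * e\<^sup>2 \<le> 15 * E" using E0 by (simp add: s_def power_mult_distrib mult_ac)
  \<comment> \<open>Take \<open>w = z\<close>, where the gap vanishes.\<close>
  have center: "E \<le> Dz\<^sup>2" using gap_ball[OF z, of 0] by simp
  have main: "s * r\<^sup>2 \<le> (r + Dz)\<^sup>2 - E" by (intro sr growth' gap_ball)
  have scaled: "s * r * \<delta> \<le> (\<delta> + Dz)\<^sup>2 - E" if \<delta>: "0 < \<delta>" "\<delta> \<le> r" for \<delta>
  proof -
    \<comment> \<open>Each point of the ball of radius \<open>r\<close> is pulled towards
      \<open>z\<close> by the factor \<open>\<delta> / r\<close>; by concavity the gap shrinks by no
      more than this factor.\<close>
    have "s * r\<^sup>2 \<le> r / \<delta> * ((\<delta> + Dz)\<^sup>2 - E)"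
    proof (intro sr growth')
      fix w assume w: "w \<in> X \<times> Y" "norm (w - z) \<le> r"
      let ?t = "\<delta> / r" and ?w = "z + (\<delta> / r) *\<^sub>R (w - z)"
      have t: "0 \<le> ?t" "?t \<le> 1" using \<delta> by auto
      have "?w = (1 - ?t) *\<^sub>R z + ?t *\<^sub>R w" by (simp add: algebra_simps)
      hence wW: "?w \<in> X \<times> Y" using convexD_alt[OF convex_W z w(1) t] by simp
      have "norm (?w - z) = ?t * norm (w - z)" using \<delta> by simp
      also have "\<dots> \<le> ?t * r" using w(2) t by (intro mult_left_mono)
      finally have "norm (?w - z) \<le> \<delta>" using \<delta> by simp
      from gap_ball[OF wW this] have "\<gamma> * real n * gap z ?w \<le> (\<delta> + Dz)\<^sup>2 - E" .
      moreover have "\<gamma> * real n * (?t * gap z w) \<le> \<gamma> * real n * gap z ?w"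
        using gamma_pos by (intro mult_left_mono gap_concave_scaling z w(1) t) auto
      ultimately have "?t * (\<gamma> * real n * gap z w) \<le> (\<delta> + Dz)\<^sup>2 - E" by (simp add: mult_ac)
      thus "\<gamma> * real n * gap z w \<le> r / \<delta> * ((\<delta> + Dz)\<^sup>2 - E)" using \<delta> by (simp add: field_simps)
    qed
    hence "(s * r * \<delta>) * r \<le> ((\<delta> + Dz)\<^sup>2 - E) * r" using \<delta> by (simp add: field_simps power2_eq_square)
    thus ?thesis using \<delta> by (simp add: mult_le_cancel_right)
  qed
  have nr: "1 \<le> real n" "real n = 1 \<or> 2 \<le> real n" using n by auto
  note regime = averaged_regime[OF rate_pos rate_le_1 nr nn dist E1 E2[unfolded s_def] center main[unfolded s_def] scaled[unfolded s_def]]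
  have r: "opt_dist (avg v n) \<le> r + e"
    using infdist_triangle[of "avg v n" "optimal_set f (X \<times> Y)" z] by (simp add: r_def e_def dist_norm)
  show "s * opt_dist (avg v n) \<le> 8 * norm (avg v n - v)" if "s \<le> 16"
  proof -
    have "s * opt_dist (avg v n) \<le> s * (r + e)" using r s by simp
    also have "\<dots> \<le> 8 * D" using regime(1) that by (simp add: s_def)
    finally show ?thesis by (simp add: D_def)
  qed
  show "(sqrt s - 2) * opt_dist (avg v n) \<le> norm (avg v n - v)" if "16 \<le> s"
  proof -
    have "sqrt 16 \<le> sqrt s" using that by (rule real_sqrt_le_mono)
    hence "2 \<le> sqrt s" by simp
    hence "(sqrt s - 2) * opt_dist (avg v n) \<le> (sqrt s - 2) * (r + e)" using r by (intro mult_left_mono) auto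
    also have "\<dots> \<le> D" using regime(2) that by (simp add: s_def)
    finally show ?thesis by (simp add: D_def)
  qed
qed

end

subsection \<open>Restarts\<close>

text \<open>The next average moves by at most twice the distance \<open>r\<close>, so the last
  property of \<open>m\<close> ensures the restart criterion at \<open>m\<close>. \<open>T\<close>
  is two less than the length threshold of the theorem.\<close>

lemma restart_length_exists:
  fixes q \<beta> r D T t :: real
  assumes q: "0 < q" and \<beta>: "0 < \<beta>" "\<beta> < 1" and t: "1 \<le> t" and nn: "0 \<le> r" "0 \<le> D"
    and T: "T = 4 * (1 + \<beta>)\<^sup>2 / \<beta>\<^sup>2 * (1 / q)"
    and small: "q * t \<le> 16 \<Longrightarrow> q * t * r \<le> 8 * D"
    and large: "16 \<le> q * t \<Longrightarrow> (sqrt (q * t) - 2) * r \<le> D"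
  obtains m :: nat where "1 \<le> m" "real m \<le> max (T + 2) ((t + (T + 2)) / 2)"
    "r \<le> \<beta> / 2 * (D / t) * real m"
proof -
  note found = that
  \<comment> \<open>\<open>x0\<close> is the value of \<open>x\<close> at \<open>t = T\<close>, and
    \<open>x0 - 2 = 2 / \<beta>\<close>.\<close>
  define x0 where "x0 = 2 * (1 + \<beta>) / \<beta>"
  define x where "x = sqrt (q * t)"
  have qt: "0 < q * t" using q t by simp
  have x: "0 < x" "x\<^sup>2 = q * t" using qt by (auto simp: x_def)
  have x0: "4 < x0" using \<beta> by (simp add: x0_def field_simps)
  have \<beta>x0: "\<beta> / 2 = 1 / (x0 - 2)" using \<beta> by (simp add: x0_def field_simps)
  have qT: "q * T = x0\<^sup>2" using q \<beta> by (simp add: T x0_def power2_eq_square field_simps)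
  have T0: "0 < T" using qT x0 q by (metis zero_less_mult_pos zero_less_power order.strict_trans zero_less_numeral)
  \<comment> \<open>A real candidate is rounded up at a cost of at most 1, which the summand 2
    beside \<open>T\<close> pays for even after halving.\<close>
  have ceil: thesis if c: "0 < c" "c + 1 \<le> max (T + 2) ((t + (T + 2)) / 2)" "r \<le> \<beta> / 2 * (D / t) * c" for c
  proof (rule found[of "nat \<lceil>c\<rceil>"])
    have "0 < \<lceil>c\<rceil>" using c by simp
    thus "1 \<le> nat \<lceil>c\<rceil>" by linarith
    show "real (nat \<lceil>c\<rceil>) \<le> max (T + 2) ((t + (T + 2)) / 2)"
      using c(1,2) of_int_ceiling_le_add_one[of c] by linarith
    have "\<beta> / 2 * (D / t) * c \<le> \<beta> / 2 * (D / t) * real (nat \<lceil>c\<rceil>)"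
      using \<beta> nn t by (intro mult_left_mono) (auto simp: of_nat_ceiling)
    thus "r \<le> \<beta> / 2 * (D / t) * real (nat \<lceil>c\<rceil>)" using c by simp
  qed
  show thesis
  proof (cases "t \<le> T")
    case True
    have "r \<le> \<beta> / 2 * (D / t) * T"
    proof (cases "q * t \<le> 16")
      case True
      have "8 \<le> x0\<^sup>2 / (x0 - 2)" using x0 zero_le_power2[of "x0 - 4"] by (simp add: field_simps power2_eq_square)
      hence "8 * D \<le> x0\<^sup>2 / (x0 - 2) * D" using nn by (intro mult_right_mono)
      hence "q * t * r \<le> q * (\<beta> / 2 * D * T)" using small True unfolding \<beta>x0 by (simp add: qT[symmetric] mult_ac)
      hence "t * r \<le> \<beta> / 2 * D * T" using q by (simp add: mult.assoc)
      thus ?thesis using t by (simp add: field_simps)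
    next
      case False
      hence "4\<^sup>2 \<le> x\<^sup>2" using x by simp
      hence x4: "4 \<le> x" by (rule power2_le_imp_le) (use x in auto)
      have "x\<^sup>2 \<le> x0\<^sup>2" using \<open>t \<le> T\<close> q x by (simp flip: qT)
      hence xx0: "x \<le> x0" by (rule power2_le_imp_le) (use x0 in auto)
      have "2 * 2 \<le> (x - 2) * (x0 - 2)" using x4 x0 by (intro mult_mono) auto
      \<comment> \<open>This factorisation expresses that \<open>x\<^sup>2 / (x - 2)\<close>
        increases from 4 on.\<close>
      hence "0 \<le> (x0 - x) * ((x - 2) * (x0 - 2) - 4)" using xx0 by (intro mult_nonneg_nonneg) auto
      hence k: "x\<^sup>2 * (x0 - 2) \<le> (x - 2) * x0\<^sup>2" by (simp add: power2_eq_square algebra_simps)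
      have "x\<^sup>2 * (x0 - 2) * r \<le> (x - 2) * x0\<^sup>2 * r" using k nn by (intro mult_right_mono)
      also have "\<dots> = x0\<^sup>2 * ((x - 2) * r)" by simp
      also have "\<dots> \<le> x0\<^sup>2 * D" using large False by (intro mult_left_mono) (auto simp: x_def)
      finally have "x\<^sup>2 * r \<le> x0\<^sup>2 * D / (x0 - 2)" using x0 by (simp add: field_simps)
      hence "q * t * r \<le> q * (\<beta> / 2 * D * T)" unfolding \<beta>x0 x qT[symmetric] by (simp add: mult_ac)
      hence "t * r \<le> \<beta> / 2 * D * T" using q by (simp add: mult.assoc)
      thus ?thesis using t by (simp add: field_simps)
    qed
    thus thesis using ceil[of T] T0 by simp
  next
    case False
    \<comment> \<open>The geometric mean of \<open>t\<close> and \<open>T\<close> suffices as a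
      length, and the arithmetic mean bounds it.\<close>
    define c where "c = sqrt (t * T)"
    have c: "0 < c" using t T0 by (simp add: c_def)
    have "c \<le> (t + T) / 2" unfolding c_def by (rule arith_geo_mean_sqrt) (use t T0 in auto)
    hence c1: "c + 1 \<le> (t + (T + 2)) / 2" by (simp add: field_simps)
    have "x0\<^sup>2 \<le> x\<^sup>2" using False q x by (simp flip: qT)
    hence xx0: "x0 \<le> x" by (rule power2_le_imp_le) (use x in auto)
    have "4\<^sup>2 \<le> x\<^sup>2" using xx0 x0 by (intro power_mono) auto
    hence L: "(x - 2) * r \<le> D" using large x by (simp add: x_def)
    have "c\<^sup>2 = t * T" using t T0 by (simp add: c_def)
    hence "(q * c)\<^sup>2 = q * t * (q * T)" by (simp add: power_mult_distrib) (simp add: power2_eq_square)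
    also have "\<dots> = (x * x0)\<^sup>2" using x qT by (simp add: power_mult_distrib)
    finally have "(q * c)\<^sup>2 = (x * x0)\<^sup>2" .
    hence qc: "q * c = x * x0" using q c x x0 by (smt (verit) mult_pos_pos power2_eq_iff)
    have "x * (x0 - 2) \<le> x0 * (x - 2)" using xx0 by (simp add: algebra_simps)
    hence "x * (x0 - 2) * r \<le> x0 * (x - 2) * r" using nn by (intro mult_right_mono)
    also have "\<dots> = x0 * ((x - 2) * r)" by simp
    also have "\<dots> \<le> x0 * D" using L x0 by (intro mult_left_mono) auto
    finally have "x * (x * (x0 - 2) * r) \<le> x * (x0 * D)" using x by (intro mult_left_mono) auto
    hence "x\<^sup>2 * r \<le> x * x0 * D / (x0 - 2)" using x0 by (simp add: field_simps power2_eq_square)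
    hence "q * t * r \<le> q * (\<beta> / 2 * D * c)" unfolding \<beta>x0 x qc[symmetric] by (simp add: mult_ac)
    hence "t * r \<le> \<beta> / 2 * D * c" using q by (simp add: mult.assoc)
    hence "r \<le> \<beta> / 2 * (D / t) * c" using t by (simp add: field_simps)
    thus thesis using c c1 by (intro ceil[of c]) linarith+
  qed
qed

text \<open>The excess over \<open>c\<close> at least halves each time; the sum plus twice the
  current excess is the induction invariant.\<close>

lemma sum_le_of_excess_halving:
  fixes a :: "nat \<Rightarrow> real"
  assumes step: "\<And>i. a (Suc i) \<le> max c ((a i + c) / 2)"
  shows "(\<Sum>i<n. a i) \<le> c * real n + 2 * max (a 0 - c) 0"
proof -
  define p where "p i = max (a i - c) 0" for i
  have half: "2 * p (Suc i) \<le> p i" for i using step[of i] by (auto simp: p_def max_def field_simps split: if_splits)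
  have "(\<Sum>i<n. a i) + 2 * p n \<le> c * real n + 2 * p 0"
  proof (induction n)
    case (Suc n)
    have "a n \<le> c + p n" by (simp add: p_def)
    thus ?case using Suc half[of n] by (simp add: algebra_simps)
  qed simp
  moreover have "0 \<le> p n" by (simp add: p_def)
  ultimately have "(\<Sum>i<n. a i) \<le> c * real n + 2 * p 0" by linarith
  thus ?thesis unfolding p_def .
qed

section \<open>Linear rate and total length\<close>

context quadratic_growth_problem
begin

lemma next_epoch_length:
  assumes v: "v \<in> X \<times> Y" and n: "1 \<le> n" and \<beta>: "0 < \<beta>" "\<beta> < 1"
    and c: "c = 4 * (1 + \<beta>)\<^sup>2 / \<beta>\<^sup>2 * (1 / (\<gamma> * \<theta>)) + 2"
  obtains m :: nat where "1 \<le> m" "real m \<le> max c ((real n + c) / 2)"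
    "opt_dist (avg v n) \<le> \<beta> / 2 * (norm (avg v n - v) / real n) * real m"
proof -
  have c2: "c - 2 = 4 * (1 + \<beta>)\<^sup>2 / \<beta>\<^sup>2 * (1 / (\<gamma> * \<theta>))" using c by simp
  have "1 \<le> real n" using n by simp
  from restart_length_exists[OF rate_pos \<beta> this infdist_nonneg norm_ge_zero c2
      epoch_opt_dist_le(1)[OF v n] epoch_opt_dist_le(2)[OF v n]]
  obtain m :: nat where "1 \<le> m" "real m \<le> max (c - 2 + 2) ((real n + (c - 2 + 2)) / 2)"
    "opt_dist (avg v n) \<le> \<beta> / 2 * (norm (avg v n - v) / real n) * real m"
    by blast
  thus thesis by (intro that) simp_all
qed

theorem adaptive_restart_bounds:
  fixes \<tau> :: "nat \<Rightarrow> nat"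
  assumes run: "adaptively_restarted_extragradient (X \<times> Y) (saddle_operator G) \<gamma> \<beta> v \<tau>"
    and \<beta>: "0 < \<beta>" "\<beta> < 1"
    and c: "c = 4 * (1 + \<beta>)\<^sup>2 / \<beta>\<^sup>2 * (1 / (\<gamma> * \<theta>)) + 2"
  shows "1 \<le> n \<Longrightarrow> opt_dist (v n) \<le> \<beta> ^ n * max 1 (c / real (\<tau> 1)) * opt_dist (v 0)"
    and "(\<Sum>i=1..n. real (\<tau> i)) \<le> c * real n + 2 * max (real (\<tau> 1) - c) 0"
proof -
  \<comment> \<open>\<open>D i\<close> is the move of epoch i + 1, and \<open>crit i\<close> is the
    restart criterion of epoch i + 2.\<close>
  define D where "D i = norm (v (Suc i) - v i)" for i
  define crit where "crit i t \<longleftrightarrow> 1 \<le> t \<and>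
    norm (avg (v (Suc i)) t - v (Suc i)) / real t \<le> \<beta> * (D i / real (\<tau> (Suc i)))" for i t
  have v0: "v 0 \<in> X \<times> Y" and \<tau>1: "1 \<le> \<tau> 1"
    and v_Suc: "v (Suc i) = avg (v i) (\<tau> (Suc i))" for i
    using run by (auto simp: adaptively_restarted_extragradient_def)
  have "\<forall>i>1. \<tau> i = (LEAST t. 1 \<le> t \<and> norm (avg (v (i - 1)) t - v (i - 1)) / real t
      \<le> \<beta> * (norm (v (i - 1) - v (i - 2)) / real (\<tau> (i - 1))))"
    using run by (auto simp: adaptively_restarted_extragradient_def)
  hence \<tau>_Suc: "\<tau> (Suc (Suc i)) = (LEAST t. crit i t)" for i
    unfolding crit_def D_def by (auto dest: spec[of _ "Suc (Suc i)"])
  have crit_ex: "\<exists>m. crit i m \<and> real m \<le> max c ((real (\<tau> (Suc i)) + c) / 2)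
      \<and> opt_dist (v (Suc i)) \<le> \<beta> / 2 * (D i / real (\<tau> (Suc i))) * real m"
    if vi: "v i \<in> X \<times> Y" and \<tau>i: "1 \<le> \<tau> (Suc i)" for i
  proof -
    obtain m :: nat where m: "1 \<le> m" "real m \<le> max c ((real (\<tau> (Suc i)) + c) / 2)"
      "opt_dist (v (Suc i)) \<le> \<beta> / 2 * (D i / real (\<tau> (Suc i))) * real m"
      using next_epoch_length[OF vi \<tau>i \<beta> c] unfolding v_Suc[symmetric] D_def by blast
    have "v (Suc i) \<in> X \<times> Y" unfolding v_Suc using vi \<tau>i by (rule avg_in)
    hence "norm (avg (v (Suc i)) m - v (Suc i)) \<le> 2 * opt_dist (v (Suc i))"
      using m(1) by (rule avg_move_le)
    also have "\<dots> \<le> \<beta> * (D i / real (\<tau> (Suc i))) * real m" using m(3) by simp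
    finally have "crit i m" using m(1) by (simp add: crit_def pos_divide_le_eq)
    with m show ?thesis by blast
  qed
  \<comment> \<open>Feasibility and positive length go through one induction: \<open>LEAST\<close>
    is meaningful only after \<open>crit_ex\<close> for the preceding epoch.\<close>
  have inv: "v i \<in> X \<times> Y \<and> 1 \<le> \<tau> (Suc i)" for i
  proof (induction i)
    case 0
    thus ?case using v0 \<tau>1 by simp
  next
    case (Suc i)
    hence vi: "v i \<in> X \<times> Y" and \<tau>i: "1 \<le> \<tau> (Suc i)" by auto
    obtain m where "crit i m" using crit_ex[OF vi \<tau>i] by blast
    hence "crit i (\<tau> (Suc (Suc i)))" unfolding \<tau>_Suc by (rule LeastI)
    moreover have "v (Suc i) \<in> X \<times> Y" unfolding v_Suc using vi \<tau>i by (rule avg_in)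
    ultimately show ?case by (simp add: crit_def)
  qed
  hence vin: "v i \<in> X \<times> Y" and \<tau>pos: "1 \<le> \<tau> (Suc i)" for i by auto
  have length: "real (\<tau> (Suc (Suc i))) \<le> max c ((real (\<tau> (Suc i)) + c) / 2)" for i
  proof -
    obtain m where m: "crit i m" "real m \<le> max c ((real (\<tau> (Suc i)) + c) / 2)"
      using crit_ex[OF vin \<tau>pos] by blast
    have "\<tau> (Suc (Suc i)) \<le> m" unfolding \<tau>_Suc using m(1) by (rule Least_le)
    thus ?thesis using m(2) by linarith
  qed
  have "(\<Sum>i<n. real (\<tau> (Suc i))) \<le> c * real n + 2 * max (real (\<tau> (Suc 0)) - c) 0"
    by (rule sum_le_of_excess_halving[where a = "\<lambda>i. real (\<tau> (Suc i))", OF length])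
  thus "(\<Sum>i=1..n. real (\<tau> i)) \<le> c * real n + 2 * max (real (\<tau> 1) - c) 0"
    by (simp add: sum.atLeast1_atMost_eq)
  have \<tau>max: "real (\<tau> (Suc i)) \<le> max c (real (\<tau> 1))" for i
  proof (induction i)
    case (Suc i)
    thus ?case using length[of i] by (auto simp: max_def field_simps split: if_splits)
  qed simp
  have speed: "D i / real (\<tau> (Suc i)) \<le> \<beta> ^ i * (D 0 / real (\<tau> 1))" for i
  proof (induction i)
    case (Suc i)
    obtain m where "crit i m" using crit_ex[OF vin \<tau>pos] by blast
    hence "crit i (\<tau> (Suc (Suc i)))" unfolding \<tau>_Suc by (rule LeastI)
    hence "D (Suc i) / real (\<tau> (Suc (Suc i))) \<le> \<beta> * (D i / real (\<tau> (Suc i)))"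
      unfolding crit_def v_Suc[symmetric] D_def[of "Suc i", symmetric] by blast
    also have "\<dots> \<le> \<beta> * (\<beta> ^ i * (D 0 / real (\<tau> 1)))" using Suc \<beta> by (intro mult_left_mono) auto
    finally show ?case by simp
  qed simp
  show "opt_dist (v n) \<le> \<beta> ^ n * max 1 (c / real (\<tau> 1)) * opt_dist (v 0)" if n: "1 \<le> n"
  proof -
    obtain k where k: "n = Suc k" using n by (cases n) auto
    \<comment> \<open>\<open>m\<close> is a sufficient length for epoch n + 1. It bounds the
      distance directly, whereas the actual length of that epoch may be smaller.\<close>
    obtain m where m: "real m \<le> max c ((real (\<tau> (Suc k)) + c) / 2)"
      "opt_dist (v n) \<le> \<beta> / 2 * (D k / real (\<tau> (Suc k))) * real m"
      using crit_ex[OF vin \<tau>pos] k by blast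
    let ?M = "max c (real (\<tau> 1))"
    have mM: "real m \<le> ?M" using m(1) \<tau>max[of k] by (auto simp: max_def field_simps split: if_splits)
    have M: "max 1 (c / real (\<tau> 1)) = ?M / real (\<tau> 1)"
      using \<tau>1 by (auto simp: max_def field_simps)
    have D0: "D 0 \<le> 2 * opt_dist (v 0)" using avg_move_le[OF v0 \<tau>1] v_Suc[of 0] by (simp add: D_def)
    have "opt_dist (v n) \<le> \<beta> / 2 * (D k / real (\<tau> (Suc k))) * real m" by (rule m(2))
    also have "\<dots> \<le> \<beta> / 2 * (\<beta> ^ k * (D 0 / real (\<tau> 1))) * ?M"
      using \<beta> speed[of k] mM by (intro mult_mono mult_left_mono) (auto simp: D_def)
    also have "\<dots> \<le> \<beta> / 2 * (\<beta> ^ k * (2 * opt_dist (v 0) / real (\<tau> 1))) * ?M"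
      using \<beta> D0 by (intro mult_right_mono mult_left_mono divide_right_mono) (auto simp: le_max_iff_disj)
    also have "\<dots> = \<beta> ^ n * (?M / real (\<tau> 1)) * opt_dist (v 0)" by (simp add: k)
    finally show ?thesis unfolding M .
  qed
qed

end

theorem theorem4:
  fixes X :: "(real^'p) set" and Y :: "(real^'m) set"
    and W :: "((real^'p) \<times> (real^'m)) set"
    and f :: "(real^'p) \<times> (real^'m) \<Rightarrow> real"
    and G :: "(real^'p) \<times> (real^'m) \<Rightarrow> (real^'p) \<times> (real^'m)"
    and L \<theta> \<gamma> \<beta> \<epsilon> tstar :: real
    and v :: "nat \<Rightarrow> (real^'p) \<times> (real^'m)" and \<tau> :: "nat \<Rightarrow> nat" and n :: nat
  assumes "closed X" and "convex X" and "closed Y" and "convex Y"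
    and W: "W = X \<times> Y"
    and "smooth_with_gradient L W f G"
    and "\<And>y. y \<in> Y \<Longrightarrow> convex_on X (\<lambda>x. f (x, y))"
    and "\<And>x. x \<in> X \<Longrightarrow> concave_on Y (\<lambda>y. f (x, y))"
    and "0 < \<theta>" and "\<theta> \<le> L"
    and "0 < \<gamma>" and "\<gamma> \<le> 1 / L"
    and "0 < \<beta>" and "\<beta> < 1"
    and "0 < \<epsilon>" and "\<epsilon> < 1"
    and "optimal_set f W \<noteq> {}"
    and "\<And>w. w \<in> W \<Longrightarrow>
           \<theta> * (infdist w (optimal_set f W))\<^sup>2
             \<le> local_gap f W (infdist w (optimal_set f W)) w"
    and tstar: "tstar = 4 * (1 + \<beta>)\<^sup>2 / \<beta>\<^sup>2 * (1 / (\<gamma> * \<theta>)) + 2"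
    and "adaptively_restarted_extragradient W (saddle_operator G) \<gamma> \<beta> v \<tau>"
    and n: "n = nat \<lceil>log (1 / \<beta>) (2 / \<epsilon> * max 1 (tstar / real (\<tau> 1)))\<rceil>"
  shows "infdist (v n) (optimal_set f W) \<le> \<epsilon> * infdist (v 0) (optimal_set f W)
    \<and> (\<Sum>i=1..n. real (\<tau> i)) \<le> tstar * real n + 2 * max (real (\<tau> 1) - tstar) 0"
proof -
  interpret quadratic_growth_problem X Y f G L \<gamma> \<theta>
    by unfold_locales (use assms in auto)
  let ?Q = "2 / \<epsilon> * max 1 (tstar / real (\<tau> 1))"
  have run: "adaptively_restarted_extragradient (X \<times> Y) (saddle_operator G) \<gamma> \<beta> v \<tau>"
    using assms by simp
  \<comment> \<open>A positive logarithm forces \<open>1 \<le> n\<close>, as the distance bound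
    requires.\<close>
  have Q: "1 < ?Q"
  proof -
    have "1 * 1 < ?Q" using \<open>0 < \<epsilon>\<close> \<open>\<epsilon> < 1\<close> by (intro mult_less_le_imp_less) auto
    thus ?thesis by simp
  qed
  have b: "1 < 1 / \<beta>" using \<open>0 < \<beta>\<close> \<open>\<beta> < 1\<close> by simp
  have "0 < log (1 / \<beta>) ?Q" using Q b by simp
  hence n1: "1 \<le> n" and "log (1 / \<beta>) ?Q \<le> real n" unfolding n by linarith+
  hence "?Q \<le> (1 / \<beta>) powr real n" using b Q by (subst (asm) log_le_iff) auto
  also have "\<dots> = 1 / \<beta> ^ n" using \<open>0 < \<beta>\<close> by (simp add: powr_realpow power_one_over)
  finally have "\<beta> ^ n * max 1 (tstar / real (\<tau> 1)) \<le> \<epsilon> / 2"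
    using \<open>0 < \<beta>\<close> \<open>0 < \<epsilon>\<close> by (simp add: field_simps)
  hence "\<beta> ^ n * max 1 (tstar / real (\<tau> 1)) * opt_dist (v 0) \<le> \<epsilon> * opt_dist (v 0)"
    using \<open>0 < \<epsilon>\<close> infdist_nonneg by (intro mult_right_mono) auto
  thus ?thesis
    using adaptive_restart_bounds[OF run \<open>0 < \<beta>\<close> \<open>\<beta> < 1\<close> tstar, of n] n1 unfolding W by auto
qed

end
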